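(* Let $k,\ell\geq 1$ be integers and let $\mathbb{C}_{k,\ell}$ denote the set of cyclic permutations of $\{1,\ldots,(k-1)(\ell-1)+1\}$ that contain no increasing cyclic sub-permutation of length $k+1$ and no decreasing cyclic sub-permutation of length $\ell+1$. Then: (1) If $\min(k,\ell)\le 2$, then $|\mathbb{C}_{k,\ell}|=1$, and its single element is the decreasing cyclic permutation when $k\le 2$ and the increasing cyclic permutation when $k\ge 3$. (2) If $\min(k,\ell)\ge 3$, then $|\mathbb{C}_{k,\ell}|=2$, and a cyclic permutation $(1,a_1,\ldots,a_{(k-1)(\ell-1)})$ of $\{1,\ldots,(k-1)(\ell-1)+1\}$ belongs to $\mathbb{C}_{k,\ell}$ if and only if the sequence $a_1,\ldots,a_{(k-1)(\ell-1)}$ satisfies one of the following: (i) for each $(i,j)\in\{1,\ldots,\ell-1\}\times\{1,\ldots,k-1\}$, $a_{(j-1)(\ell-1)+i}=(\ell-1-i)(k-1)+j+1$; (ii) for each $(i,j)\in\{1,\ldots,\ell-1\}\times\{1,\ldots,k-1\}$, $a_{(i-1)(k-1)+j}=(j-1)(\ell-1)+(\ell-i)+1$.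
   Context: A cyclic permutation of a finite set of distinct integers is an arrangement of its elements in a circle, written $(j_1,\ldots,j_n)$, where two such expressions denote the same cyclic permutation if one is a cyclic rotation of the other; its length is $n$. Every cyclic permutation of $\{1,\ldots,N\}$ can be written uniquely starting with $1$. A cyclic sub-permutation of $\sigma$ is obtained by deleting some elements of $\sigma$ and keeping the rest in their cyclic order. A cyclic permutation is increasing if it can be written as $(j_1,\ldots,j_n)$ with $j_1<\cdots<j_n$, and decreasing if it can be written as $(j_1,\ldots,j_n)$ with $j_1>\cdots>j_n$. *)

theory Defs
  imports Main "HOL-Library.Sublist"
begin

definition rotation_of :: "'a list \<Rightarrow> 'a list \<Rightarrow> bool" where
  "rotation_of xs ys \<longleftrightarrow> (\<exists>n. ys = rotate n xs)"

lemma equivp_rotation_of: "equivp (rotation_of :: 'a list \<Rightarrow> _)"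
proof (rule equivpI)
  show "reflp (rotation_of :: 'a list \<Rightarrow> _)"
    by (rule reflpI) (metis rotation_of_def rotate0 id_apply)
  show "symp (rotation_of :: 'a list \<Rightarrow> _)"
  proof (rule sympI)
    fix xs ys :: "'a list"
    assume "rotation_of xs ys"
    then obtain n where ys: "ys = rotate n xs"
      by (auto simp: rotation_of_def)
    have "rotate (length xs - n mod length xs) ys = xs"
    proof (cases "xs = []")
      case False
      then have "n mod length xs \<le> length xs"
        by (simp add: less_imp_le)
      then show ?thesis
        by (metis ys rotate_rotate rotate_conv_mod le_add_diff_inverse2 rotate_id mod_self)
    qed (simp add: ys)
    then show "rotation_of ys xs"
      by (metis rotation_of_def)
  qed
  show "transp (rotation_of :: 'a list \<Rightarrow> _)"
    by (rule transpI) (auto simp: rotation_of_def rotate_rotate)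
qed

text \<open>Circular arrangements: lists up to rotation. The constructor \<open>Cyc\<close> sends the list
  \<open>[j\<^sub>1, \<dots>, j\<^sub>n]\<close> to the arrangement \<open>(j\<^sub>1, \<dots>, j\<^sub>n)\<close>.\<close>

quotient_type 'a cyc = "'a list" / rotation_of
  morphisms Rep_cyc Cyc
  by (rule equivp_rotation_of)

lift_definition cyc_length :: "'a cyc \<Rightarrow> nat" is length
  by (auto simp: rotation_of_def)

lift_definition cyc_set :: "'a cyc \<Rightarrow> 'a set" is set
  by (auto simp: rotation_of_def)

lift_definition cyc_distinct :: "'a cyc \<Rightarrow> bool" is distinct
  by (auto simp: rotation_of_def)

definition cyclic_perms :: "'a set \<Rightarrow> 'a cyc set" where
  "cyclic_perms A = {\<sigma>. cyc_distinct \<sigma> \<and> cyc_set \<sigma> = A}"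

definition cyclic_sub :: "'a cyc \<Rightarrow> 'a cyc \<Rightarrow> bool" where
  "cyclic_sub \<tau> \<sigma> \<longleftrightarrow> (\<exists>ys xs. \<tau> = Cyc ys \<and> \<sigma> = Cyc xs \<and> subseq ys xs)"

definition cyc_increasing :: "'a::linorder cyc \<Rightarrow> bool" where
  "cyc_increasing \<sigma> \<longleftrightarrow> (\<exists>xs. \<sigma> = Cyc xs \<and> sorted_wrt (<) xs)"

definition cyc_decreasing :: "'a::linorder cyc \<Rightarrow> bool" where
  "cyc_decreasing \<sigma> \<longleftrightarrow> (\<exists>xs. \<sigma> = Cyc xs \<and> sorted_wrt (>) xs)"

definition CC :: "nat \<Rightarrow> nat \<Rightarrow> nat cyc set" where
  "CC k l = {\<sigma> \<in> cyclic_perms {1..(k - 1) * (l - 1) + 1}.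
     \<not> (\<exists>\<tau>. cyclic_sub \<tau> \<sigma> \<and> cyc_increasing \<tau> \<and> cyc_length \<tau> = k + 1) \<and>
     \<not> (\<exists>\<tau>. cyclic_sub \<tau> \<sigma> \<and> cyc_decreasing \<tau> \<and> cyc_length \<tau> = l + 1)}"

end

theory Submission imports Defs begin

text \<open>
  Put \<open>m = k - 1\<close>, \<open>n = l - 1\<close>, \<open>N = m n + 1\<close>, and view a cyclic permutation as a set of \<open>N\<close> points on the
  torus, one in each row and each column. Both forbidden patterns are invariant under rotating positions
  and rotating values, so every point may serve as the origin. Seen from an origin, the remaining
  \<open>m n\<close> points have no increasing chain of length \<open>m + 1\<close> and no decreasing chain of length \<open>n + 1\<close>; this is the
  extremal case of Erdos--Szekeres, in which the pairs (increasing rank, decreasing rank) fill the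
  grid \<open>{1..m} \<times> {1..n}\<close> exactly. Comparing the grids seen from two consecutive points \<open>O\<close>, \<open>Q\<close> shows that the
  step from \<open>O\<close> to \<open>Q\<close> is \<open>n\<close> or \<open>-m\<close> modulo \<open>N\<close>, according to whether the point preceding \<open>O\<close> lies above or
  below \<open>Q\<close>. Going from a step \<open>n\<close> to a step \<open>-m\<close> forces \<open>m < n\<close>, and the other change forces \<open>n < m\<close>, so around
  the circle the step is constant and the arrangement is \<open>p \<mapsto> n p\<close> or \<open>p \<mapsto> -m p\<close> modulo \<open>N\<close>.
  Conversely, on each of these two lattices a linear form with coefficient sum \<open>k\<close> (respectively \<open>l\<close>) takes
  positive multiples of \<open>N\<close> on all increasing (respectively decreasing) steps, which bounds the chains.
\<close>

subsection \<open>Extremal Erdos--Szekeres labellings\<close>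

text \<open>Only the range and the monotonicity of the two ranks are recorded, not how they arise
  from longest chains. This keeps the notion symmetric: reversing the order of heights exchanges
  \<open>f\<close> with \<open>g\<close> and \<open>m\<close> with \<open>n\<close>.\<close>

locale ES_labelling =
  fixes m n :: nat and c :: "nat \<Rightarrow> int" and f g :: "nat \<Rightarrow> nat"
  assumes inj_c: "inj_on c {1..m * n}"
    and f_range: "i \<in> {1..m * n} \<Longrightarrow> f i \<in> {1..m}"
    and g_range: "i \<in> {1..m * n} \<Longrightarrow> g i \<in> {1..n}"
    and f_less: "\<lbrakk>i \<in> {1..m * n}; j \<in> {1..m * n}; i < j; c i < c j\<rbrakk> \<Longrightarrow> f i < f j"
    and g_less: "\<lbrakk>i \<in> {1..m * n}; j \<in> {1..m * n}; i < j; c j < c i\<rbrakk> \<Longrightarrow> g i < g j"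
begin

lemma c_neq: "\<lbrakk>i \<in> {1..m * n}; j \<in> {1..m * n}; i \<noteq> j\<rbrakk> \<Longrightarrow> c i \<noteq> c j"
  using inj_onD[OF inj_c] by blast

text \<open>Two distinct indices form either an increasing or a decreasing pair, so one of the two
  ranks separates them.\<close>

lemma label_inj:
  assumes "i \<in> {1..m * n}" "j \<in> {1..m * n}" "f i = f j" "g i = g j"
  shows "i = j"
  using assms
proof (induction i j rule: linorder_wlog)
  case (le i j)
  show ?case
  proof (rule ccontr)
    assume "i \<noteq> j"
    with le have "i < j" and "c i \<noteq> c j" using c_neq by auto
    then show False using f_less[of i j] g_less[of i j] le by fastforce
  qed
next
  case (sym i j)
  then show ?case by simp
qed

text \<open>Pigeonhole with equality: an injection from m n indices into a grid with m n cells hits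
  every cell.\<close>

lemma label_surj:
  assumes "a \<in> {1..m}" "b \<in> {1..n}"
  obtains i where "i \<in> {1..m * n}" "f i = a" "g i = b"
proof -
  let ?l = "\<lambda>i. (f i, g i)"
  have inj: "inj_on ?l {1..m * n}"
    using label_inj by (auto intro!: inj_onI)
  have sub: "?l ` {1..m * n} \<subseteq> {1..m} \<times> {1..n}"
    using f_range g_range by auto
  have "?l ` {1..m * n} = {1..m} \<times> {1..n}"
    by (rule card_subset_eq) (use inj sub in \<open>auto simp: card_image\<close>)
  then have "(a, b) \<in> ?l ` {1..m * n}" using assms by blast
  then show thesis using that by auto
qed

lemma same_f:
  assumes "i \<in> {1..m * n}" "j \<in> {1..m * n}" "f i = f j" "i < j"
  shows "c j < c i" "g i < g j"
proof -
  show "c j < c i" using assms f_less[of i j] c_neq[of i j] by fastforce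
  then show "g i < g j" using assms g_less by blast
qed

lemma same_g:
  assumes "i \<in> {1..m * n}" "j \<in> {1..m * n}" "g i = g j" "i < j"
  shows "c i < c j" "f i < f j"
proof -
  show "c i < c j" using assms g_less[of i j] c_neq[of i j] by fastforce
  then show "f i < f j" using assms f_less by blast
qed

text \<open>The index labelled (1, 1) cannot be preceded by index 1, which would then have a rank
  below 1 in one of the coordinates.\<close>

lemma first_label:
  assumes "1 \<le> m * n"
  shows "f 1 = 1" "g 1 = 1"
proof -
  have pos: "1 \<in> {1..m}" "1 \<in> {1..n}"
    using assms by (auto simp: Suc_le_eq)
  obtain i where i: "i \<in> {1..m * n}" "f i = 1" "g i = 1"
    using label_surj[OF pos] by blast
  have one: "1 \<in> {1..m * n}" using assms by simp
  have "i = 1"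
  proof (rule ccontr)
    assume "i \<noteq> 1"
    then have "1 < i" using i by auto
    then show False
      using f_less[OF one i(1)] g_less[OF one i(1)] c_neq[OF one i(1)] i f_range[OF one] g_range[OF one]
      by fastforce
  qed
  then show "f 1 = 1" "g 1 = 1" using i by auto
qed

lemma last_label:
  assumes "1 \<le> m * n"
  shows "f (m * n) = m" "g (m * n) = n"
proof -
  have pos: "m \<in> {1..m}" "n \<in> {1..n}"
    using assms by (auto simp: Suc_le_eq)
  obtain i where i: "i \<in> {1..m * n}" "f i = m" "g i = n"
    using label_surj[OF pos] by blast
  have last: "m * n \<in> {1..m * n}" using assms by simp
  have "i = m * n"
  proof (rule ccontr)
    assume "i \<noteq> m * n"
    then have "i < m * n" using i by auto
    then show False
      using f_less[OF i(1) last] g_less[OF i(1) last] c_neq[OF i(1) last] i f_range[OF last] g_range[OF last]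
      by fastforce
  qed
  then show "f (m * n) = m" "g (m * n) = n" using i by auto
qed

end

lemma strict_chain_bound:
  fixes \<phi> :: "nat \<Rightarrow> nat"
  assumes less: "\<And>r s. \<lbrakk>a \<le> r; r < s; s \<le> b\<rbrakk> \<Longrightarrow> \<phi> r < \<phi> s" and "a \<le> b"
  shows "\<phi> a + (b - a) \<le> \<phi> b"
proof -
  have "\<phi> a + t \<le> \<phi> (a + t)" if "a + t \<le> b" for t
    using that
  proof (induction t)
    case (Suc t)
    have "\<phi> (a + t) < \<phi> (a + Suc t)" using Suc.prems by (intro less) auto
    then show ?case using Suc by simp
  qed simp
  from this[of "b - a"] show ?thesis using \<open>a \<le> b\<close> by simp
qed

text \<open>
  Here \<open>c\<close> lists the heights of the other points seen from \<open>O\<close>, the point at index \<open>1\<close> being \<open>Q\<close>, and \<open>c'\<close>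
  those seen from \<open>Q\<close>, where \<open>O\<close> has index \<open>m * n\<close>. If the last point lies above \<open>Q\<close>, so does the whole
  column \<open>f = m\<close>, and the point with \<open>(f, g) = (m, 1)\<close> has \<open>(f', g') = (m - 1, 1)\<close>. Hence the row \<open>g' = 1\<close> lies above
  \<open>Q\<close> up to \<open>f' = m - 1\<close>, which pushes every point below \<open>Q\<close> into the column \<open>f' = m\<close>.
\<close>

lemma consecutive_frames:
  fixes c c' :: "nat \<Rightarrow> int"
  defines "v \<equiv> c 1"
  assumes O: "ES_labelling m n c f g" and Q: "ES_labelling m n c' f' g'"
    and range: "\<And>i. i \<in> {1..m * n} \<Longrightarrow> c i \<in> {1..int (m * n)}"
    and above: "\<And>i. \<lbrakk>i \<in> {1..m * n}; i \<noteq> 1; v < c i\<rbrakk> \<Longrightarrow> c' (i - 1) = c i - v"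
    and below: "\<And>i. \<lbrakk>i \<in> {1..m * n}; i \<noteq> 1; c i < v\<rbrakk> \<Longrightarrow> c' (i - 1) = c i - v + int (m * n + 1)"
    and base: "c' (m * n) = int (m * n + 1) - v"
    and M: "2 \<le> m * n" and last: "v < c (m * n)"
  shows "v = int n"
proof -
  interpret O: ES_labelling m n c f g by (rule O)
  interpret Q: ES_labelling m n c' f' g' by (rule Q)
  let ?M = "m * n"
  have "m \<noteq> 0" "n \<noteq> 0" using M by (metis mult_0 mult_0_right not_numeral_le_zero)+
  then have mpos: "m \<in> {1..m}" "1 \<in> {1..m}" and npos: "1 \<in> {1..n}"
    by auto
  have M1: "1 \<le> ?M" using M by linarith
  then have oneM: "1 \<in> {1..?M}" and MM: "?M \<in> {1..?M}" by (simp_all only: atLeastAtMost_iff order_refl)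
  have bM: "c i \<le> int ?M" "1 \<le> c i" if "i \<in> {1..?M}" for i using range[OF that] by auto
  have "\<exists>e. \<forall>r\<in>{1..n}. e r \<in> {1..?M} \<and> f (e r) = m \<and> g (e r) = r"
    using O.label_surj[OF mpos(1)] by (intro bchoice) blast
  then obtain e where e: "\<And>r. r \<in> {1..n} \<Longrightarrow> e r \<in> {1..?M} \<and> f (e r) = m \<and> g (e r) = r"
    by blast
  have "\<exists>\<alpha>. \<forall>i\<in>{1..m}. \<alpha> i \<in> {1..?M} \<and> f (\<alpha> i) = i \<and> g (\<alpha> i) = 1"
    using O.label_surj[OF _ npos] by (intro bchoice) blast
  then obtain \<alpha> where \<alpha>: "\<And>i. i \<in> {1..m} \<Longrightarrow> \<alpha> i \<in> {1..?M} \<and> f (\<alpha> i) = i \<and> g (\<alpha> i) = 1"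
    by blast
  \<comment> \<open>Points of one column descend with the index, and the column \<open>f = m\<close>
    ends at the last index, whose labels are (m, n). So the whole column lies above the last point,
    hence above Q.\<close>
  have e_above: "v < c (e r)" if r: "r \<in> {1..n}" for r
  proof (cases "e r = ?M")
    case True
    then show ?thesis using last by simp
  next
    case False
    then have "e r < ?M" using e[OF r] by auto
    then have "c ?M < c (e r)"
      using O.same_f[of "e r" ?M] e[OF r] O.last_label[OF M1] MM by auto
    then show ?thesis using last by simp
  qed
  have e_ge2: "2 \<le> e r" if r: "r \<in> {1..n}" for r
  proof -
    have "e r \<noteq> 1" using e_above[OF r] by (auto simp: v_def)
    then show ?thesis using e[OF r] by auto
  qed
  have e_c': "c' (e r - 1) = c (e r) - v" if r: "r \<in> {1..n}" for r
    using above[of "e r"] e[OF r] e_above[OF r] e_ge2[OF r] by auto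
  \<comment> \<open>Moving the origin to Q lowers every index by 1. The column \<open>f = m\<close>,
    lying above Q, is only translated and stays a decreasing chain of n points; since
    \<open>g'\<close> takes values in 1..n, its first point must have \<open>g' = 1\<close>.\<close>
  have "g' (e r - 1) < g' (e s - 1)" if "1 \<le> r" "r < s" "s \<le> n" for r s
  proof -
    have rs: "r \<in> {1..n}" "s \<in> {1..n}" using that by auto
    have lt: "e r < e s"
    proof (rule ccontr)
      assume "\<not> e r < e s"
      moreover have "e r \<noteq> e s" using e[OF rs(1)] e[OF rs(2)] that by (metis less_irrefl)
      ultimately have "e s < e r" by simp
      then show False using O.same_f(2)[of "e s" "e r"] e[OF rs(1)] e[OF rs(2)] that by (metis less_asym)
    qed
    then have "c (e s) < c (e r)" using O.same_f(1) e[OF rs(1)] e[OF rs(2)] by auto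
    then have "c' (e s - 1) < c' (e r - 1)" using e_c' rs by simp
    moreover have "e r - 1 \<in> {1..?M}" "e s - 1 \<in> {1..?M}" "e r - 1 < e s - 1"
      using lt e_ge2[OF rs(1)] e[OF rs(1)] e[OF rs(2)] by auto
    ultimately show ?thesis using Q.g_less by blast
  qed
  then have "g' (e 1 - 1) + (n - 1) \<le> g' (e n - 1)"
    using npos by (intro strict_chain_bound) auto
  moreover have "e 1 - 1 \<in> {1..?M}" "e n - 1 \<in> {1..?M}"
    using e[of 1] e[of n] e_ge2[of 1] e_ge2[of n] npos by auto
  ultimately have g'e: "g' (e 1 - 1) = 1"
    using Q.g_range[of "e 1 - 1"] Q.g_range[of "e n - 1"] npos
    unfolding atLeastAtMost_iff by linarith
  have e1M: "e 1 - 1 \<in> {1..?M}" "e 1 - 1 < ?M"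
    using e[OF npos] e_ge2[OF npos] by auto
  have \<alpha>m: "\<alpha> m = e 1"
    using O.label_inj \<alpha>[OF mpos(1)] e[OF npos] by auto
  have \<alpha>1: "\<alpha> 1 = 1"
    using O.label_inj[of "\<alpha> 1" 1] \<alpha>[OF mpos(2)] O.first_label[OF M1] oneM by auto
  have m2: "2 \<le> m"
    using \<alpha>m \<alpha>1 e_ge2[OF npos] mpos by (cases "m = 1") auto
  have \<alpha>_less: "\<alpha> i < \<alpha> j" "c (\<alpha> i) < c (\<alpha> j)" if "1 \<le> i" "i < j" "j \<le> m" for i j
  proof -
    have ij: "i \<in> {1..m}" "j \<in> {1..m}" using that by auto
    show lt: "\<alpha> i < \<alpha> j"
    proof (rule ccontr)
      assume "\<not> \<alpha> i < \<alpha> j"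
      moreover have "\<alpha> i \<noteq> \<alpha> j" using \<alpha>[OF ij(1)] \<alpha>[OF ij(2)] that by (metis less_irrefl)
      ultimately have "\<alpha> j < \<alpha> i" by simp
      then show False using O.same_g(2)[of "\<alpha> j" "\<alpha> i"] \<alpha>[OF ij(1)] \<alpha>[OF ij(2)] that by (metis less_asym)
    qed
    then show "c (\<alpha> i) < c (\<alpha> j)" using O.same_g(1) \<alpha>[OF ij(1)] \<alpha>[OF ij(2)] by auto
  qed
  \<comment> \<open>The row \<open>g = 1\<close> starts at Q itself, which is lost as the new
    origin. The other m - 1 points remain an increasing chain, so its end \<open>e 1\<close> has
    \<open>f'\<close> at least m - 1.\<close>
  have "f' (\<alpha> i - 1) < f' (\<alpha> j - 1)" if "2 \<le> i" "i < j" "j \<le> m" for i j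
  proof -
    have "\<alpha> 1 < \<alpha> i" "v < c (\<alpha> i)" "v < c (\<alpha> j)" "\<alpha> i < \<alpha> j" "c (\<alpha> i) < c (\<alpha> j)"
      using \<alpha>_less[of 1 i] \<alpha>_less[of 1 j] \<alpha>_less[of i j] that \<alpha>1 by (auto simp: v_def)
    moreover have "\<alpha> i \<in> {1..?M}" "\<alpha> j \<in> {1..?M}" using \<alpha> that by auto
    moreover from calculation have "c' (\<alpha> i - 1) = c (\<alpha> i) - v" "c' (\<alpha> j - 1) = c (\<alpha> j) - v"
      using \<alpha>1 by (intro above; auto)+
    ultimately show ?thesis using \<alpha>1 by (intro Q.f_less) auto
  qed
  then have "f' (\<alpha> 2 - 1) + (m - 2) \<le> f' (\<alpha> m - 1)"
    using m2 by (intro strict_chain_bound) auto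
  moreover have "1 \<le> f' (\<alpha> 2 - 1)"
  proof -
    have "\<alpha> 1 < \<alpha> 2" using \<alpha>_less[of 1 2] m2 by auto
    then have "\<alpha> 2 - 1 \<in> {1..?M}" using \<alpha>[of 2] m2 \<alpha>1 by auto
    then show ?thesis using Q.f_range by fastforce
  qed
  ultimately have f'e_ge: "m - 1 \<le> f' (e 1 - 1)" using \<alpha>m m2 by auto
  \<comment> \<open>Seen from Q, the old origin O has the last index and height N - v. It lies above
    and after \<open>e 1\<close>, which leaves m - 1 as the only value of \<open>f'\<close> at
    \<open>e 1\<close>.\<close>
  have e1_lt: "c' (e 1 - 1) < int (?M + 1) - v"
    using e_c'[OF npos] bM[of "e 1"] e[OF npos] by auto
  then have "f' (e 1 - 1) < f' ?M"
    using base e1M MM by (intro Q.f_less) auto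
  then have f'e: "f' (e 1 - 1) = m - 1" and f'M: "f' ?M = m"
    using f'e_ge Q.f_range[OF MM] m2 by auto
  \<comment> \<open>Points below Q wrap around to heights above that of O. If such a point had
    \<open>f' < m\<close>, the point \<open>q\<close> of its column in row \<open>g' = 1\<close>
    would lie no higher than \<open>e 1\<close>, hence below it; but \<open>q\<close> must be the
    top of that column.\<close>
  have below_f': "f' i = m" if i: "i \<in> {1..?M}" "int (?M + 1) - v < c' i" for i
  proof (rule ccontr)
    assume "f' i \<noteq> m"
    then have fi: "f' i \<in> {1..m}" "f' i \<le> m - 1" using Q.f_range[OF i(1)] by auto
    obtain q where q: "q \<in> {1..?M}" "f' q = f' i" "g' q = 1"
      using Q.label_surj[OF fi(1) npos] by blast
    have "q \<le> e 1 - 1"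
    proof (rule ccontr)
      assume "\<not> q \<le> e 1 - 1"
      then have "e 1 - 1 < q" by simp
      then have "f' (e 1 - 1) < f' q" using Q.same_g(2) e1M(1) g'e q by metis
      then show False using f'e q fi by simp
    qed
    then have "c' q \<le> c' (e 1 - 1)"
      using Q.same_g(1)[of q "e 1 - 1"] e1M(1) g'e q by (metis le_neq_implies_less order.order_iff_strict)
    then have cq: "c' q < c' i" using e1_lt i by simp
    then have "i \<noteq> q" by auto
    then consider "i < q" | "q < i" by linarith
    then show False
    proof cases
      case 1
      then have "g' i < 1" using Q.same_f(2)[of i q] i q by simp
      then show False using Q.g_range[OF i(1)] by simp
    next
      case 2
      then have "c' i < c' q" using Q.same_f(1)[of q i] i q by simp
      then show False using cq by simp
    qed
  qed
  \<comment> \<open>The heights are a bijection onto 1..m n, so exactly v - 1 points lie below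
    Q.\<close>
  let ?B = "{i \<in> {1..?M}. c i < v}"
  have surj_c: "c ` {1..?M} = {1..int ?M}"
    by (rule card_subset_eq) (use range O.inj_c in \<open>auto simp: card_image simp del: of_nat_mult\<close>)
  have cardB: "int (card ?B) = v - 1"
  proof -
    have v: "1 \<le> v" "v \<le> int ?M" using bM[OF oneM] by (simp_all add: v_def del: of_nat_mult)
    have "c ` ?B = {1..<v}" 
    proof
      show "{1..<v} \<subseteq> c ` ?B"
      proof
        fix x assume x: "x \<in> {1..<v}"
        then have "x \<in> c ` {1..?M}" using v unfolding surj_c by simp
        then show "x \<in> c ` ?B" using x by auto
      qed
    qed (use bM in auto)
    moreover have "inj_on c ?B" using O.inj_c by (rule inj_on_subset) auto
    ultimately have "card ?B = card {1..<v}" by (metis card_image)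
    then show ?thesis using v by simp
  qed
  \<comment> \<open>Together with O, the points below Q all have \<open>f' = m\<close>. A column has
    at most n points, which gives v <= n.\<close>
  have "card (insert ?M ((\<lambda>i. i - 1) ` ?B)) \<le> card {1..n}"
  proof (rule card_inj_on_le)
    have B: "i \<in> {1..?M}" "i \<noteq> 1" "c' (i - 1) = c i - v + int (?M + 1)" if "i \<in> ?B" for i
      using that below[of i] by (auto simp: v_def)
    have mem: "j \<in> {1..?M} \<and> f' j = m" if "j \<in> insert ?M ((\<lambda>i. i - 1) ` ?B)" for j
    proof (cases "j = ?M")
      case True
      then show ?thesis using MM f'M by simp
    next
      case False
      then obtain i where i: "i \<in> ?B" "j = i - 1" using \<open>j \<in> _\<close> by auto
      have "j \<in> {1..?M}" using B(1,2)[OF i(1)] i(2) by auto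
      moreover have "int (?M + 1) - v < c' j" using B[OF i(1)] bM(2)[of i] i(2) by simp
      ultimately show ?thesis using below_f' by blast
    qed
    then show "g' ` insert ?M ((\<lambda>i. i - 1) ` ?B) \<subseteq> {1..n}"
      using Q.g_range by blast
    show "inj_on g' (insert ?M ((\<lambda>i. i - 1) ` ?B))"
    proof (rule inj_onI)
      fix x y
      assume "x \<in> insert ?M ((\<lambda>i. i - 1) ` ?B)" "y \<in> insert ?M ((\<lambda>i. i - 1) ` ?B)" "g' x = g' y"
      then show "x = y" using mem[of x] mem[of y] Q.label_inj[of x y] by metis
    qed
  qed simp
  moreover have "card (insert ?M ((\<lambda>i. i - 1) ` ?B)) = card ?B + 1"
  proof -
    have "inj_on (\<lambda>i. i - 1) ?B" by (auto simp: inj_on_def)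
    moreover have "?M \<notin> (\<lambda>i. i - 1) ` ?B" by auto
    ultimately show ?thesis by (simp add: card_image)
  qed
  ultimately have le: "v \<le> int n" using cardB by simp
  \<comment> \<open>For the reverse bound, the n points of the column \<open>f = 1\<close> descend
    from Q, so their distinct heights fit into 1..v.\<close>
  have "card {1..n} \<le> card {1..v}"
  proof -
    have "\<exists>b. \<forall>r\<in>{1..n}. b r \<in> {1..?M} \<and> f (b r) = 1 \<and> g (b r) = r"
      using O.label_surj[OF mpos(2)] by (intro bchoice) blast
    then obtain b where b: "\<And>r. r \<in> {1..n} \<Longrightarrow> b r \<in> {1..?M} \<and> f (b r) = 1 \<and> g (b r) = r"
      by blast
    have "c (b r) \<in> {1..v}" if r: "r \<in> {1..n}" for r
    proof (cases "b r = 1")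
      case True
      then show ?thesis using bM[OF oneM] by (auto simp: v_def)
    next
      case False
      then have "1 < b r" using b[OF r] by auto
      then have "c (b r) < c 1" using O.same_f(1)[of 1 "b r"] b[OF r] O.first_label[OF M1] oneM by auto
      then show ?thesis using bM b[OF r] by (auto simp: v_def)
    qed
    moreover have "inj_on (c \<circ> b) {1..n}"
    proof (rule comp_inj_on)
      show "inj_on b {1..n}" by (rule inj_on_inverseI[where g = g]) (use b in auto)
      show "inj_on c (b ` {1..n})" using O.inj_c by (rule inj_on_subset) (use b in auto)
    qed
    ultimately show ?thesis by (intro card_inj_on_le[of "c \<circ> b"]) auto
  qed
  then have "n \<le> nat v" by simp
  moreover have "1 \<le> v" using bM[OF oneM] by (simp add: v_def)
  ultimately show ?thesis using le by linarith
qed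

subsection \<open>Arrangements that are extremal from every point\<close>

text \<open>The view from the point at position \<open>p\<close>: both torus coordinates are
  translated so that this point becomes the origin.\<close>

definition frame :: "nat \<Rightarrow> (nat \<Rightarrow> int) \<Rightarrow> nat \<Rightarrow> nat \<Rightarrow> int" where
  "frame N h p i = (h (p + i) - h p) mod int N"

text \<open>Heights are integers that matter only modulo N, so that the reflection
  \<open>- h\<close> is again an instance; N consecutive positions carry distinct residues.\<close>

locale extremal_arrangement =
  fixes m n N :: nat and h :: "nat \<Rightarrow> int"
  assumes N_eq: "N = m * n + 1"
    and periodic: "h (i + N) = h i"
    and incongruent: "\<lbrakk>i < j; j < i + N\<rbrakk> \<Longrightarrow> \<not> int N dvd h j - h i"
    and labelled: "\<exists>f g. ES_labelling m n (frame N h p) f g"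
begin

lemma N_pos: "0 < int N"
  unfolding N_eq of_nat_0_less_iff by simp

lemma frame_range:
  assumes "i \<in> {1..m * n}"
  shows "frame N h p i \<in> {1..int (m * n)}"
proof -
  have "\<not> int N dvd h (p + i) - h p" using assms N_eq by (intro incongruent) auto
  then have "frame N h p i \<noteq> 0" by (simp add: frame_def dvd_eq_mod_eq_0)
  moreover have "0 \<le> frame N h p i" "frame N h p i < int N" 
    unfolding frame_def using N_pos by (simp_all only: pos_mod_sign pos_mod_bound)
  ultimately show ?thesis using N_eq by simp
qed

lemma frame_shift: "frame N h (p + 1) i = (frame N h p (i + 1) - frame N h p 1) mod int N"
  by (simp add: frame_def mod_diff_eq add_ac)

lemma frame_last:
  assumes "1 \<le> m * n"
  shows "frame N h (p + 1) (m * n) = int N - frame N h p 1"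
proof -
  have "frame N h (p + 1) (m * n) = (- frame N h p 1) mod int N"
  proof -
    have "frame N h p (m * n + 1) = 0"
      using periodic[of p] by (simp add: frame_def N_eq add_ac)
    then show ?thesis unfolding frame_shift by simp
  qed
  moreover have "frame N h p 1 \<in> {1..int (m * n)}" using assms by (intro frame_range) simp
  ultimately show ?thesis using N_eq
    by (simp add: zmod_zminus1_eq_if)
qed

lemma step_eq_n:
  assumes "2 \<le> m * n" and last: "frame N h p 1 < frame N h p (m * n)"
  shows "frame N h p 1 = int n"
proof -
  obtain f g where O: "ES_labelling m n (frame N h p) f g" using labelled by blast
  obtain f' g' where Q: "ES_labelling m n (frame N h (p + 1)) f' g'" using labelled by blast
  have one: "1 \<in> {1..m * n}" using assms by (simp del: One_nat_def)
  show ?thesis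
  proof (rule consecutive_frames[OF O Q frame_range])
    fix i assume i: "i \<in> {1..m * n}" "i \<noteq> 1"
    then have eq: "frame N h (p + 1) (i - 1) = (frame N h p i - frame N h p 1) mod int N"
      unfolding frame_shift by simp
    note r = frame_range[OF i(1), of p] frame_range[OF one, of p]
    show "frame N h (p + 1) (i - 1) = frame N h p i - frame N h p 1"
      if "frame N h p 1 < frame N h p i"
      unfolding eq using that r N_eq by (intro mod_pos_pos_trivial) auto
    show "frame N h (p + 1) (i - 1) = frame N h p i - frame N h p 1 + int (m * n + 1)"
      if "frame N h p i < frame N h p 1"
    proof -
      have "(frame N h p i - frame N h p 1) mod int N = (frame N h p i - frame N h p 1 + int N) mod int N"
        by simp
      also have "\<dots> = frame N h p i - frame N h p 1 + int N"
        using that r N_eq by (intro mod_pos_pos_trivial) auto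
      finally show ?thesis using eq N_eq by simp
    qed
  next
    have "1 \<le> m * n" using assms(1) by linarith
    from frame_last[OF this, of p] show "frame N h (p + 1) (m * n) = int (m * n + 1) - frame N h p 1"
      using N_eq by simp
  qed (use assms in simp_all)
qed

lemma frame_reflect:
  assumes "i \<in> {1..m * n}"
  shows "frame N (\<lambda>i. - h i) p i = int N - frame N h p i"
proof -
  have "frame N (\<lambda>i. - h i) p i = (- (h (p + i) - h p)) mod int N" by (simp add: frame_def)
  also have "\<dots> = int N - frame N h p i"
    using frame_range[OF assms, of p] unfolding zmod_zminus1_eq_if by (auto simp: frame_def)
  finally show ?thesis .
qed

text \<open>Reflecting the values turns increasing chains into decreasing ones, which swaps m with n
  and \<open>f\<close> with \<open>g\<close>. It yields the step -m from the step n without a second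
  comparison of frames.\<close>

lemma reflect: "extremal_arrangement n m N (\<lambda>i. - h i)"
proof
  show "N = n * m + 1" using N_eq by simp
  show "- h (i + N) = - h i" for i using periodic by simp
  show "\<not> int N dvd - h j - - h i" if "i < j" "j < i + N" for i j
    using incongruent[OF that] by (metis minus_diff_eq dvd_minus_iff diff_minus_eq_add add.commute uminus_add_conv_diff)
  show "\<exists>f g. ES_labelling n m (frame N (\<lambda>i. - h i) p) f g" for p
  proof -
    obtain f g where "ES_labelling m n (frame N h p) f g" using labelled by blast
    then interpret E: ES_labelling m n "frame N h p" f g .
    note neg = frame_reflect[of _ p]
    have comm: "n * m = m * n" by simp
    have "ES_labelling n m (frame N (\<lambda>i. - h i) p) g f"
    proof (unfold_locales, unfold comm)
      show "inj_on (frame N (\<lambda>i. - h i) p) {1..m * n}"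
        using inj_onD[OF E.inj_c] neg by (intro inj_onI) simp
    qed (use E.f_range E.g_range E.f_less E.g_less neg in \<open>simp_all del: atLeastAtMost_iff\<close>)
    then show ?thesis by blast
  qed
qed

lemma step_eq_m:
  assumes "2 \<le> m * n" and last: "frame N h p (m * n) < frame N h p 1"
  shows "frame N h p 1 = int N - int m"
proof -
  interpret R: extremal_arrangement n m N "\<lambda>i. - h i" by (rule reflect)
  have "1 \<in> {1..m * n}" "m * n \<in> {1..m * n}" using assms by (simp_all del: One_nat_def)
  note neg = frame_reflect[OF this(1), of p] frame_reflect[OF this(2), of p]
  have "frame N (\<lambda>i. - h i) p 1 = int m"
    using R.step_eq_n[of p] assms neg by (simp add: mult.commute)
  then show ?thesis using neg by simp
qed

text \<open>From position p + 1 the last visible point is the one at p, at height N minus the step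
  taken at p. Hence the current step is the threshold data that decides the next one.\<close>

lemma step_dichotomy:
  assumes "2 \<le> m * n"
  shows "frame N h (p + 1) 1 < int N - frame N h p 1 \<Longrightarrow> frame N h (p + 1) 1 = int n"
    and "frame N h (p + 1) 1 > int N - frame N h p 1 \<Longrightarrow> frame N h (p + 1) 1 = int N - int m"
    and "frame N h (p + 1) 1 \<noteq> int N - frame N h p 1"
proof -
  have M: "1 \<le> m * n" using assms by linarith
  note last = frame_last[OF M, of p]
  show "frame N h (p + 1) 1 < int N - frame N h p 1 \<Longrightarrow> frame N h (p + 1) 1 = int n"
    using step_eq_n[OF assms] last by simp
  show "frame N h (p + 1) 1 > int N - frame N h p 1 \<Longrightarrow> frame N h (p + 1) 1 = int N - int m"
    using step_eq_m[OF assms] last by simp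
  obtain f g where "ES_labelling m n (frame N h (p + 1)) f g" using labelled by blast
  then have "inj_on (frame N h (p + 1)) {1..m * n}" by (simp add: ES_labelling_def)
  then have "frame N h (p + 1) 1 \<noteq> frame N h (p + 1) (m * n)"
    using assms M by (auto dest!: inj_onD[of _ _ 1 "m * n"])
  then show "frame N h (p + 1) 1 \<noteq> int N - frame N h p 1" using last by simp
qed

lemma frame_periodic: "frame N h (p + N * t) i = frame N h p i"
proof -
  have "h (q + N * t) = h q" for q
  proof (induction t)
    case (Suc t)
    then show ?case using periodic[of "q + N * t"] by (simp add: add_ac)
  qed simp
  from this[of p] this[of "p + i"] show ?thesis by (simp add: frame_def add_ac)
qed

lemma step_persistent_imp_constant:
  assumes persist: "\<And>p. frame N h p 1 = d \<Longrightarrow> frame N h (p + 1) 1 = d"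
    and start: "frame N h p 1 = d"
  shows "frame N h q 1 = d"
proof -
  have later: "frame N h (p + t) 1 = d" for t
    by (induction t) (use start persist[of "p + _"] in \<open>simp_all add: add_ac\<close>)
  \<comment> \<open>Persistence only propagates forwards. Going around p times puts a copy of
    \<open>q\<close> at or beyond \<open>p\<close>, because N is at least 1.\<close>
  have "p + (q + N * p - p) = q + N * p" using N_eq by simp
  then have "frame N h (q + N * p) 1 = d" using later[of "q + N * p - p"] by simp
  then show ?thesis by (simp add: frame_periodic)
qed

lemma step_constant:
  assumes "2 \<le> m * n"
  shows "(\<forall>p. frame N h p 1 = int n) \<or> (\<forall>p. frame N h p 1 = int N - int m)"
proof -
  have two': "frame N h (p + 1) 1 = int n \<or> frame N h (p + 1) 1 = int N - int m" for p
    using step_dichotomy[OF assms, of p] by linarith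
  have two: "frame N h p 1 = int n \<or> frame N h p 1 = int N - int m" for p
  proof -
    \<comment> \<open>Position 0 has no predecessor among the naturals, so the previous point is
      taken one full turn later.\<close>
    have "p + N * 1 = (p + m * n) + 1" using N_eq by simp
    then show ?thesis using two'[of "p + m * n"] frame_periodic[of p 1 1] by metis
  qed
  show ?thesis
  \<comment> \<open>After a step -m the threshold is m, so a following step n would need n < m.
    After a step n the threshold is N - n, so a following step -m would need m < n. Thus in each
    case one of the two steps is absorbing.\<close>
  proof (cases "m \<le> n")
    case True
    have "frame N h (p + 1) 1 = int N - int m" if "frame N h p 1 = int N - int m" for p
      using step_dichotomy[OF assms, of p] that True by linarith
    then show ?thesis using step_persistent_imp_constant two by metis
  next
    case False
    have "frame N h (p + 1) 1 = int n" if "frame N h p 1 = int n" for p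
      using step_dichotomy[OF assms, of p] that False by linarith
    then show ?thesis using step_persistent_imp_constant two by metis
  qed
qed

lemma affine:
  "(\<forall>p. int N dvd h p - h 0 - int n * int p) \<or> (\<forall>p. int N dvd h p - h 0 + int m * int p)"
proof -
  have lin: "int N dvd h p - h 0 - d * int p" if "\<And>p. int N dvd frame N h p 1 - d" for d p
  proof (induction p)
    case (Suc p)
    have "int N dvd (h (p + 1) - h p) - d"
      using that[of p] by (simp add: frame_def mod_eq_dvd_iff[symmetric] mod_diff_left_eq dvd_eq_mod_eq_0)
    from dvd_add[OF this Suc] show ?case by (simp add: algebra_simps)
  qed simp
  \<comment> \<open>Comparing frames requires two points besides the origin. For m n = 0 the modulus
    is 1, and for m n = 1 the only nonzero residue is 1 = n.\<close>
  consider "m * n = 0" | "m * n = 1" | "2 \<le> m * n" by linarith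
  then show ?thesis
  proof cases
    case 1
    then have "N = 1" using N_eq by simp
    then show ?thesis by simp
  next
    case 2
    have "frame N h p 1 = int n" for p using frame_range[of 1 p] 2 by simp
    then show ?thesis using lin[of "int n"] by simp
  next
    case 3
    then consider "\<And>p. frame N h p 1 = int n" | "\<And>p. frame N h p 1 = int N - int m"
      using step_constant by blast
    then show ?thesis
    proof cases
      case 1
      then show ?thesis using lin[of "int n"] by simp
    next
      case 2
      then show ?thesis using lin[of "- int m"] by simp
    qed
  qed
qed

end

subsection \<open>Cyclic sub-permutations and chains\<close>

text \<open>The rank of \<open>i\<close> is the largest size of an increasing set ending at
  \<open>i\<close>. Appending \<open>j\<close> to an optimal set for \<open>i\<close> makes the rank
  grow, and a set larger than K would contain an excluded one of size exactly K + 1.\<close>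

lemma chain_rank_exists:
  fixes c :: "nat \<Rightarrow> int"
  assumes no_chain: "\<And>S. \<lbrakk>S \<subseteq> {1..M}; card S = K + 1\<rbrakk> \<Longrightarrow> \<not> strict_mono_on S c"
  obtains f :: "nat \<Rightarrow> nat" where "\<And>i. i \<in> {1..M} \<Longrightarrow> f i \<in> {1..K}"
    and "\<And>i j. \<lbrakk>i \<in> {1..M}; j \<in> {1..M}; i < j; c i < c j\<rbrakk> \<Longrightarrow> f i < f j"
proof -
  define A where "A i = {S. S \<subseteq> {1..i} \<and> i \<in> S \<and> strict_mono_on S c}" for i
  define f where "f i = Max (card ` A i)" for i
  have fin: "finite (card ` A i)" for i
    by (rule finite_imageI, rule finite_subset[of _ "Pow {1..i}"]) (auto simp: A_def)
  have sing: "{i} \<in> A i" if "1 \<le> i" for i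
    using that by (auto simp: A_def monotone_on_def)
  have attained: "\<exists>S\<in>A i. card S = f i" if "1 \<le> i" for i
  proof -
    have "f i \<in> card ` A i" unfolding f_def using fin sing[OF that] by (intro Max_in) auto
    then show ?thesis by auto
  qed
  have bound: "card S \<le> f i" if "S \<in> A i" for S i
    unfolding f_def using fin that by (intro Max_ge) auto
  show thesis
  proof
    fix i assume i: "i \<in> {1..M}"
    obtain S where S: "S \<in> A i" "card S = f i" using attained i by auto
    have "f i \<le> K"
    proof (rule ccontr)
      assume "\<not> f i \<le> K"
      then have "K + 1 \<le> card S" using S by simp
      then obtain T where T: "T \<subseteq> S" "card T = K + 1"
        by (rule obtain_subset_with_card_n)
      then have "T \<subseteq> {1..M}" "strict_mono_on T c"
        using S i by (auto simp: A_def intro: monotone_on_subset)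
      then show False using no_chain T by blast
    qed
    moreover have "1 \<le> f i" using bound[OF sing] i by fastforce
    ultimately show "f i \<in> {1..K}" by simp
  next
    fix i j assume ij: "i \<in> {1..M}" "j \<in> {1..M}" "i < j" "c i < c j"
    obtain S where S: "S \<in> A i" "card S = f i" using attained ij by auto
    have le: "c x \<le> c i \<and> x < j" if "x \<in> S" for x
    proof (cases "x = i")
      case False
      then have "x < i" using S that by (fastforce simp: A_def)
      then show ?thesis using S that ij by (auto simp: A_def monotone_on_def intro: less_imp_le)
    qed (use ij in auto)
    have "strict_mono_on (insert j S) c"
    proof (rule strict_mono_onI)
      fix x y assume xy: "x \<in> insert j S" "y \<in> insert j S" "x < y"
      then have x: "x \<in> S" using le[of y] by auto
      show "c x < c y"
      proof (cases "y = j")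
        case True
        then show ?thesis using le[OF x] ij by auto
      next
        case False
        then show ?thesis using xy x S by (auto simp: A_def monotone_on_def)
      qed
    qed
    then have "insert j S \<in> A j" using S ij by (fastforce simp: A_def)
    moreover have "card (insert j S) = card S + 1"
    proof -
      have "finite S" using S by (auto simp: A_def intro: finite_subset)
      moreover have "j \<notin> S" using le by blast
      ultimately show ?thesis by simp
    qed
    ultimately show "f i < f j" using bound[of "insert j S" j] S by simp
  qed
qed

lemma ES_labelling_exists:
  fixes c :: "nat \<Rightarrow> int"
  assumes "inj_on c {1..m * n}"
    and "\<And>S. \<lbrakk>S \<subseteq> {1..m * n}; card S = m + 1\<rbrakk> \<Longrightarrow> \<not> strict_mono_on S c"
    and "\<And>S. \<lbrakk>S \<subseteq> {1..m * n}; card S = n + 1\<rbrakk> \<Longrightarrow> \<not> strict_mono_on S (\<lambda>i. - c i)"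
  shows "\<exists>f g. ES_labelling m n c f g"
proof -
  obtain f where f: "\<And>i. i \<in> {1..m * n} \<Longrightarrow> f i \<in> {1..m}"
    "\<And>i j. \<lbrakk>i \<in> {1..m * n}; j \<in> {1..m * n}; i < j; c i < c j\<rbrakk> \<Longrightarrow> f i < f j"
    using chain_rank_exists[of "m * n" m c] assms(2) by blast
  obtain g where g: "\<And>i. i \<in> {1..m * n} \<Longrightarrow> g i \<in> {1..n}"
    "\<And>i j. \<lbrakk>i \<in> {1..m * n}; j \<in> {1..m * n}; i < j; - c i < - c j\<rbrakk> \<Longrightarrow> g i < g j"
    using chain_rank_exists[of "m * n" n "\<lambda>i. - c i"] assms(3) by blast
  have "ES_labelling m n c f g"
    by unfold_locales (use assms(1) f g in \<open>simp_all del: atLeastAtMost_iff\<close>)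
  then show ?thesis by blast
qed

section \<open>Rotations and monotonicity seen from a base value\<close>

lemma Cyc_eq_iff: "Cyc xs = Cyc ys \<longleftrightarrow> (\<exists>n. ys = rotate n xs)"
  by (simp add: cyc.abs_eq_iff rotation_of_def)

lemma Cyc_rotate: "Cyc (rotate n xs) = Cyc xs"
  using Cyc_eq_iff by metis

lemma Cyc_append_commute: "Cyc (xs @ ys) = Cyc (ys @ xs)"
  by (metis Cyc_rotate rotate_append)

lemma rotate_eq_map_nth:
  "rotate p xs = map (\<lambda>i. xs ! ((p + i) mod length xs)) [0..<length xs]"
  by (rule nth_equalityI) (simp_all add: nth_rotate)

text \<open>Used to cut a list at the place where its values wrap around modulo N.\<close>

lemma sorted_wrt_eq_append_filter:
  assumes "sorted_wrt R ys" and "\<And>x y. \<lbrakk>x \<in> set ys; y \<in> set ys; \<not> P x; P y\<rbrakk> \<Longrightarrow> \<not> R x y"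
  shows "ys = filter P ys @ filter (\<lambda>x. \<not> P x) ys"
  using assms
proof (induction ys)
  case (Cons x ys)
  then have IH: "ys = filter P ys @ filter (\<lambda>x. \<not> P x) ys" by auto
  show ?case
  proof (cases "P x")
    case True
    then show ?thesis using IH by simp
  next
    case False
    then have "\<not> P y" if "y \<in> set ys" for y using Cons.prems that by auto
    then have "filter P ys = []" by (simp add: filter_empty_conv)
    then show ?thesis using IH False by simp
  qed
qed simp

lemma shift_mod_cases:
  fixes b x N :: nat
  assumes "b \<in> {1..N}" "x \<in> {1..N}"
  shows "(int x - int b) mod int N = (if b \<le> x then int x - int b else int x - int b + int N)"
proof (cases "b \<le> x")
  case False
  have "(int x - int b) mod int N = (int x - int b + int N) mod int N" by simp
  also have "\<dots> = int x - int b + int N" using False assms by (intro mod_pos_pos_trivial) auto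
  finally show ?thesis using False by simp
qed (use assms in \<open>auto intro!: mod_pos_pos_trivial\<close>)

text \<open>Measured upwards from \<open>b\<close>, the values at least \<open>b\<close> come first
  and those below \<open>b\<close> follow after the wrap. Exchanging these two blocks is a rotation
  and sorts the list.\<close>

lemma cyc_increasing_shift:
  fixes b N :: nat
  assumes b: "b \<in> {1..N}" and ys: "set ys \<subseteq> {1..N}"
    and sorted: "sorted_wrt (\<lambda>x y. (int x - int b) mod int N < (int y - int b) mod int N) ys"
  shows "cyc_increasing (Cyc ys)"
proof -
  let ?us = "filter (\<lambda>x. b \<le> x) ys" and ?vs = "filter (\<lambda>x. \<not> b \<le> x) ys"
  have key: "(int x - int b) mod int N = (if b \<le> x then int x - int b else int x - int b + int N)"
    if "x \<in> set ys" for x using that b ys by (intro shift_mod_cases) auto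
  have split: "ys = ?us @ ?vs"
    by (rule sorted_wrt_eq_append_filter[OF sorted]) (use ys b in \<open>auto simp: key\<close>)
  have "sorted_wrt (<) ?us" "sorted_wrt (<) ?vs"
    using sorted by (auto intro!: sorted_wrt_mono_rel[OF _ sorted_wrt_filter[OF sorted]] simp: key)
  then have "sorted_wrt (<) (?vs @ ?us)" by (auto simp: sorted_wrt_append)
  then show ?thesis
    unfolding cyc_increasing_def using split Cyc_append_commute by metis
qed

lemma cyc_decreasing_shift:
  fixes b N :: nat
  assumes b: "b \<in> {1..N}" and ys: "set ys \<subseteq> {1..N}"
    and sorted: "sorted_wrt (\<lambda>x y. (int y - int b) mod int N < (int x - int b) mod int N) ys"
  shows "cyc_decreasing (Cyc ys)"
proof -
  let ?us = "filter (\<lambda>x. x < b) ys" and ?vs = "filter (\<lambda>x. \<not> x < b) ys"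
  have key: "(int x - int b) mod int N = (if b \<le> x then int x - int b else int x - int b + int N)"
    if "x \<in> set ys" for x using that b ys by (intro shift_mod_cases) auto
  have split: "ys = ?us @ ?vs"
    by (rule sorted_wrt_eq_append_filter[OF sorted]) (use ys b in \<open>auto simp: key\<close>)
  have "sorted_wrt (>) ?us" "sorted_wrt (>) ?vs"
    using sorted by (auto intro!: sorted_wrt_mono_rel[OF _ sorted_wrt_filter[OF sorted]] simp: key)
  then have "sorted_wrt (>) (?vs @ ?us)" by (auto simp: sorted_wrt_append)
  then show ?thesis
    unfolding cyc_decreasing_def using split Cyc_append_commute by metis
qed

section \<open>From excluded cyclic patterns to extremal arrangements\<close>

definition heights :: "nat list \<Rightarrow> nat \<Rightarrow> int" where
  "heights xs i = int (xs ! (i mod length xs))"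

lemma heights_neq:
  assumes "distinct xs" "i < j" "j < i + length xs"
  shows "heights xs i \<noteq> heights xs j"
proof
  assume eq: "heights xs i = heights xs j"
  have pos: "0 < length xs" using assms by linarith
  have "i mod length xs = j mod length xs"
    using eq assms(1) pos by (simp add: heights_def nth_eq_iff_index_eq)
  then have "length xs dvd j - i" using assms(2) mod_eq_dvd_iff_nat[of i j "length xs"] by simp
  then show False using assms by (auto dest!: dvd_imp_le)
qed

lemma heights_range:
  assumes "set xs = {1..N}" "length xs = N" "0 < N"
  shows "xs ! (i mod N) \<in> {1..N}"
  using assms by (metis mod_less_divisor nth_mem)

lemma heights_incongruent:
  assumes "distinct xs" "set xs = {1..N}" "length xs = N" "i < j" "j < i + N"
  shows "\<not> int N dvd heights xs j - heights xs i"
proof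
  assume "int N dvd heights xs j - heights xs i"
  then have dvd: "int N dvd \<bar>heights xs j - heights xs i\<bar>" by simp
  have "0 < N" using assms by simp
  then have "\<bar>heights xs j - heights xs i\<bar> < int N"
    using heights_range[OF assms(2,3), of i] heights_range[OF assms(2,3), of j] assms(3)
    by (auto simp: heights_def)
  moreover have "heights xs j - heights xs i \<noteq> 0"
    using heights_neq[OF assms(1,4)] assms by fastforce
  ultimately show False using zdvd_imp_le[OF dvd] by simp
qed

lemma frame_heights_pos:
  assumes "distinct xs" "set xs = {1..N}" "length xs = N" "i \<in> {1..<N}"
  shows "0 < frame N (heights xs) p i"
proof -
  have "\<not> int N dvd heights xs (p + i) - heights xs p"
    using assms by (intro heights_incongruent) auto
  then have "frame N (heights xs) p i \<noteq> 0" by (simp add: frame_def dvd_eq_mod_eq_0)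
  moreover have "0 \<le> frame N (heights xs) p i" using assms by (simp add: frame_def)
  ultimately show ?thesis by simp
qed

text \<open>The origin has offset 0 and height 0, so it can be put in front of any increasing chain
  of its frame; this accounts for the extra 1 in the length.\<close>

lemma increasing_sub_of_frame_chain:
  assumes xs: "distinct xs" "set xs = {1..N}" "length xs = N"
    and S: "S \<subseteq> {1..<N}" "strict_mono_on S (frame N (heights xs) p)" and N: "0 < N"
  shows "\<exists>\<tau>. cyclic_sub \<tau> (Cyc xs) \<and> cyc_increasing \<tau> \<and> cyc_length \<tau> = card S + 1"
proof -
  define ps where "ps = filter (\<lambda>i. i \<in> insert 0 S) [0..<N]"
  define ys where "ys = map (\<lambda>i. xs ! ((p + i) mod N)) ps"
  have set_ps: "set ps = insert 0 S" using S N by (auto simp: ps_def)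
  have "subseq ys (rotate p xs)"
    unfolding ys_def ps_def rotate_eq_map_nth using xs by (simp add: subseq_map)
  then have sub: "cyclic_sub (Cyc ys) (Cyc xs)"
    unfolding cyclic_sub_def using Cyc_rotate by metis
  have "finite S" "0 \<notin> S" using S by (auto intro: finite_subset)
  moreover have "distinct ps" by (simp add: ps_def)
  ultimately have len: "length ys = card S + 1"
    using distinct_card[of ps] set_ps by (simp add: ys_def)
  have "sorted_wrt (<) ps" by (simp add: ps_def sorted_wrt_filter)
  then have sorted: "sorted_wrt (\<lambda>i j. frame N (heights xs) p i < frame N (heights xs) p j) ps"
  proof (rule sorted_wrt_mono_rel[rotated])
    fix i j assume ij: "i \<in> set ps" "j \<in> set ps" "i < j"
    then have j: "j \<in> S" using set_ps by auto
    show "frame N (heights xs) p i < frame N (heights xs) p j"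
    proof (cases "i = 0")
      case True
      then show ?thesis using frame_heights_pos[OF xs, of j p] j S by (auto simp: frame_def)
    next
      case False
      then show ?thesis using ij j set_ps S(2) by (auto simp: monotone_on_def)
    qed
  qed
  have "cyc_increasing (Cyc ys)"
  proof (rule cyc_increasing_shift)
    show "xs ! (p mod N) \<in> {1..N}" using heights_range xs N by simp
    show "set ys \<subseteq> {1..N}" using heights_range[OF xs(2,3) N] by (auto simp: ys_def)
    show "sorted_wrt (\<lambda>x y. (int x - int (xs ! (p mod N))) mod int N < (int y - int (xs ! (p mod N))) mod int N) ys"
      using sorted xs by (simp add: ys_def sorted_wrt_map frame_def heights_def)
  qed
  then show ?thesis using sub len by (auto simp: cyc_length.abs_eq)
qed

lemma decreasing_sub_of_frame_chain:
  assumes xs: "distinct xs" "set xs = {1..N}" "length xs = N"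
    and S: "S \<subseteq> {1..<N}" "strict_mono_on S (\<lambda>i. - frame N (heights xs) p i)" and N: "0 < N"
  shows "\<exists>\<tau>. cyclic_sub \<tau> (Cyc xs) \<and> cyc_decreasing \<tau> \<and> cyc_length \<tau> = card S + 1"
proof -
  \<comment> \<open>The base point is read at index \<open>N\<close> instead of \<open>0\<close>, so that it comes last.\<close>
  define ps where "ps = filter (\<lambda>i. i \<in> insert N S) [1..<N + 1]"
  define ys where "ys = map (\<lambda>i. xs ! ((p + i) mod N)) ps"
  have set_ps: "set ps = insert N S" using S N by (auto simp: ps_def)
  have "rotate (p + 1) xs = map (\<lambda>i. xs ! ((p + i) mod N)) [1..<N + 1]"
    by (rule nth_equalityI) (use xs in \<open>simp_all add: nth_rotate del: upt_Suc rotate_Suc\<close>)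
  then have "subseq ys (rotate (p + 1) xs)"
    unfolding ys_def ps_def by (simp add: subseq_map del: upt_Suc)
  then have sub: "cyclic_sub (Cyc ys) (Cyc xs)"
    unfolding cyclic_sub_def using Cyc_rotate by metis
  have "finite S" "N \<notin> S" using S by (auto intro: finite_subset)
  moreover have "distinct ps" by (simp add: ps_def)
  ultimately have len: "length ys = card S + 1"
    using distinct_card[of ps] set_ps by (simp add: ys_def)
  have base: "frame N (heights xs) p N = 0" using xs by (simp add: frame_def heights_def)
  have "sorted_wrt (<) ps" unfolding ps_def by (rule sorted_wrt_filter) (simp del: upt_Suc)
  then have sorted: "sorted_wrt (\<lambda>i j. frame N (heights xs) p j < frame N (heights xs) p i) ps"
  proof (rule sorted_wrt_mono_rel[rotated])
    fix i j assume ij: "i \<in> set ps" "j \<in> set ps" "i < j"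
    then have i: "i \<in> S" using set_ps S by auto
    show "frame N (heights xs) p j < frame N (heights xs) p i"
    proof (cases "j = N")
      case True
      then show ?thesis using frame_heights_pos[OF xs, of i p] i S base by auto
    next
      case False
      then show ?thesis using ij i set_ps S(2) by (auto simp: monotone_on_def)
    qed
  qed
  have "cyc_decreasing (Cyc ys)"
  proof (rule cyc_decreasing_shift)
    show "xs ! (p mod N) \<in> {1..N}" using heights_range xs N by simp
    show "set ys \<subseteq> {1..N}" using heights_range[OF xs(2,3) N] by (auto simp: ys_def)
    show "sorted_wrt (\<lambda>x y. (int y - int (xs ! (p mod N))) mod int N < (int x - int (xs ! (p mod N))) mod int N) ys"
      using sorted xs by (simp add: ys_def sorted_wrt_map frame_def heights_def)
  qed
  then show ?thesis using sub len by (auto simp: cyc_length.abs_eq)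
qed

text \<open>A chain of m + 1 points in some frame becomes, with its origin, an increasing cyclic
  sub-permutation of length m + 2 = k + 1; likewise for decreasing chains and n. So the exclusions
  bound the chains of every frame.\<close>

lemma CC_extremal_arrangement:
  fixes m n N :: nat
  assumes N: "N = m * n + 1" and xs: "distinct xs" "set xs = {1..N}"
    and CC: "Cyc xs \<in> CC (m + 1) (n + 1)"
  shows "extremal_arrangement m n N (heights xs)"
proof
  have len: "length xs = N" using distinct_card[OF xs(1)] xs(2) by simp
  have pos: "0 < N" using N by simp
  show "N = m * n + 1" by (rule N)
  show "heights xs (i + N) = heights xs i" for i by (simp add: heights_def len)
  show incong: "\<not> int N dvd heights xs j - heights xs i" if "i < j" "j < i + N" for i j
    using heights_incongruent[OF xs len that] .
  show "\<exists>f g. ES_labelling m n (frame N (heights xs) p) f g" for p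
  proof (rule ES_labelling_exists)
    show "inj_on (frame N (heights xs) p) {1..m * n}"
    proof (rule linorder_inj_onI)
      fix i j assume ij: "i < j" "i \<in> {1..m * n}" "j \<in> {1..m * n}"
      have "\<not> int N dvd heights xs (p + j) - heights xs (p + i)"
        using ij N by (intro incong) auto
      then show "frame N (heights xs) p i \<noteq> frame N (heights xs) p j"
        by (metis (no_types, lifting) frame_def mod_eq_dvd_iff diff_diff_eq2 diff_add_cancel)
    qed auto
    show "\<not> strict_mono_on S (frame N (heights xs) p)" if "S \<subseteq> {1..m * n}" "card S = m + 1" for S
    proof
      assume "strict_mono_on S (frame N (heights xs) p)"
      moreover have "S \<subseteq> {1..<N}" using that N by auto
      ultimately have "\<exists>\<tau>. cyclic_sub \<tau> (Cyc xs) \<and> cyc_increasing \<tau> \<and> cyc_length \<tau> = card S + 1"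
        using pos by (intro increasing_sub_of_frame_chain[OF xs len])
      then show False using CC that(2) unfolding CC_def by fastforce
    qed
    show "\<not> strict_mono_on S (\<lambda>i. - frame N (heights xs) p i)" if "S \<subseteq> {1..m * n}" "card S = n + 1" for S
    proof
      assume "strict_mono_on S (\<lambda>i. - frame N (heights xs) p i)"
      moreover have "S \<subseteq> {1..<N}" using that N by auto
      ultimately have "\<exists>\<tau>. cyclic_sub \<tau> (Cyc xs) \<and> cyc_decreasing \<tau> \<and> cyc_length \<tau> = card S + 1"
        using pos by (intro decreasing_sub_of_frame_chain[OF xs len])
      then show False using CC that(2) unfolding CC_def by fastforce
    qed
  qed
qed

subsection \<open>The two lattice arrangements\<close>

lemma sorted_wrt_nths: "sorted_wrt R xs \<Longrightarrow> sorted_wrt R (nths xs I)"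
  by (induction xs arbitrary: I) (auto simp: nths_Cons dest: in_set_nthsD)

text \<open>\<open>cyclic_sub\<close> allows any representatives of both arrangements. Rotating the
  shorter list exchanges two blocks; cutting the longer list accordingly and exchanging its blocks
  as well absorbs that rotation.\<close>

lemma cyclic_sub_subseq_rotate:
  assumes "cyclic_sub (Cyc zs) (Cyc xs)"
  shows "\<exists>q. subseq zs (rotate q xs)"
proof -
  obtain ys xs' where eq: "Cyc zs = Cyc ys" "Cyc xs = Cyc xs'" and sub: "subseq ys xs'"
    using assms unfolding cyclic_sub_def by blast
  obtain b where b: "xs' = rotate b xs" using eq(2) Cyc_eq_iff by blast
  obtain a where "zs = rotate a ys" using eq(1) Cyc_eq_iff by metis
  then obtain us vs where split: "ys = us @ vs" "zs = vs @ us"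
    using rotate_drop_take append_take_drop_id by metis
  then obtain us' vs' where "xs' = us' @ vs'" "subseq us us'" "subseq vs vs'"
    using list_emb_appendD sub by metis
  then have "subseq zs (rotate (length us') xs')"
    using split by (simp add: rotate_append list_emb_append_mono)
  then show ?thesis using b rotate_rotate by metis
qed

text \<open>One period of the torus lattice generated by (1, d), with values shifted by 1 so that
  the list begins with 1.\<close>

definition lattice_list :: "nat \<Rightarrow> int \<Rightarrow> nat list" where
  "lattice_list N d = map (\<lambda>p. nat (d * int p mod int N) + 1) [0..<N]"

lemma length_lattice_list [simp]: "length (lattice_list N d) = N"
  by (simp add: lattice_list_def)

lemma lattice_list_nth: "p < N \<Longrightarrow> lattice_list N d ! p = nat (d * int p mod int N) + 1"
  by (simp add: lattice_list_def)

lemma rotate_lattice_list: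
  "rotate q (lattice_list N d) = map (\<lambda>i. nat (d * int (q + i) mod int N) + 1) [0..<N]"
proof (rule nth_equalityI)
  fix i assume "i < length (rotate q (lattice_list N d))"
  then have i: "i < N" by simp
  have "d * int ((q + i) mod N) mod int N = d * int (q + i) mod int N"
    by (simp only: zmod_int mod_mult_right_eq)
  then show "rotate q (lattice_list N d) ! i = map (\<lambda>i. nat (d * int (q + i) mod int N) + 1) [0..<N] ! i"
    using i by (simp add: nth_rotate lattice_list_nth)
qed simp

text \<open>Along the chain the form \<open>\<alpha> x + \<beta> y\<close> grows by a positive multiple of \<open>N\<close> at each step, while its
  total growth is less than \<open>(\<alpha> + \<beta>) N\<close>.\<close>

lemma chain_length_le:
  fixes \<alpha> \<beta> N :: nat and y :: "nat \<Rightarrow> int"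
  assumes ps: "sorted_wrt (<) ps" "set ps \<subseteq> {0..<N}"
    and y: "sorted_wrt (\<lambda>i j. y i < y j) ps" "\<And>i j. \<lbrakk>i \<in> set ps; j \<in> set ps\<rbrakk> \<Longrightarrow> y j - y i < int N"
    and dvd: "\<And>i j. \<lbrakk>i \<in> set ps; j \<in> set ps\<rbrakk> \<Longrightarrow>
      int N dvd int \<alpha> * (int j - int i) + int \<beta> * (y j - y i)"
    and pos: "0 < \<alpha> + \<beta>"
  shows "length ps \<le> \<alpha> + \<beta>"
proof (cases "ps = []")
  case False
  have N: "0 < N" using False ps by (cases ps) auto
  define H where "H i = int \<alpha> * int i + int \<beta> * y i" for i
  have climb: "H (ps ! 0) + int t * int N \<le> H (ps ! t)" if "t < length ps" for t
    using that
  proof (induction t)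
    case (Suc t)
    let ?i = "ps ! t" and ?j = "ps ! Suc t"
    have ij: "?i \<in> set ps" "?j \<in> set ps" using Suc.prems by auto
    have "?i < ?j" "y ?i < y ?j"
      using sorted_wrt_nth_less[OF ps(1), of t "Suc t"] sorted_wrt_nth_less[OF y(1), of t "Suc t"] Suc.prems
      by auto
    then have "int \<alpha> * 1 \<le> int \<alpha> * (int ?j - int ?i)" "int \<beta> * 1 \<le> int \<beta> * (y ?j - y ?i)"
      by (intro mult_left_mono; simp)+
    then have "0 < int \<alpha> * (int ?j - int ?i) + int \<beta> * (y ?j - y ?i)" using pos by linarith
    then have "int N \<le> int \<alpha> * (int ?j - int ?i) + int \<beta> * (y ?j - y ?i)"
      using dvd[OF ij] by (intro zdvd_imp_le)
    then have "H ?i + int N \<le> H ?j" by (simp add: H_def algebra_simps)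
    then show ?case using Suc by (simp add: algebra_simps)
  qed simp
  let ?i = "ps ! 0" and ?j = "ps ! (length ps - 1)"
  have ij: "?i \<in> set ps" "?j \<in> set ps" using False by auto
  then have "?j < N" using ps by auto
  then have "int \<alpha> * (int ?j - int ?i) \<le> int \<alpha> * (int N - 1)" "int \<beta> * (y ?j - y ?i) \<le> int \<beta> * (int N - 1)"
    using y(2)[OF ij] by (intro mult_left_mono; simp)+
  then have "H ?j - H ?i \<le> int (\<alpha> + \<beta>) * (int N - 1)"
    by (simp add: H_def algebra_simps)
  moreover have "H ?i + int (length ps - 1) * int N \<le> H ?j"
    using climb[of "length ps - 1"] False by simp
  moreover have "int (\<alpha> + \<beta>) * (int N - 1) < int (\<alpha> + \<beta>) * int N"
    using pos by (intro mult_strict_left_mono) auto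
  ultimately have "int (length ps - 1) * int N < int (\<alpha> + \<beta>) * int N" by linarith
  then have "length ps - 1 < \<alpha> + \<beta>" using N by (simp only: mult_less_cancel_right) linarith
  then show ?thesis by linarith
qed simp

lemma lattice_value_dvd:
  fixes N :: nat and d :: int
  assumes "0 < N"
  shows "int N dvd int (nat (d * int (q + i) mod int N) + 1) - (d * int (q + i) + 1)"
proof -
  have "int (nat (d * int (q + i) mod int N) + 1) = d * int (q + i) mod int N + 1" using assms by simp
  then show ?thesis by (simp add: mod_eq_dvd_iff[symmetric])
qed

text \<open>The rotation offset \<open>q\<close> cancels in differences, so any sub-list is
  described by positions and values whose differences satisfy y = d x modulo N.\<close>

lemma subseq_rotate_lattice_listE:
  assumes "subseq zs (rotate q (lattice_list N d))" and N: "0 < N"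
  obtains ps y where "sorted_wrt (<) ps" "set ps \<subseteq> {0..<N}" "zs = map y ps"
    "\<And>i j. int (y j) - int (y i) < int N"
    "\<And>i j. int N dvd (int (y j) - int (y i)) - d * (int j - int i)"
proof -
  define y where "y i = nat (d * int (q + i) mod int N) + 1" for i
  obtain I where "zs = map y (nths [0..<N] I)"
    using assms unfolding rotate_lattice_list y_def[symmetric] subseq_conv_nths nths_map by blast
  moreover have "sorted_wrt (<) (nths [0..<N] I)" by (simp add: sorted_wrt_nths)
  moreover have "set (nths [0..<N] I) \<subseteq> {0..<N}" using set_nths_subset by fastforce
  moreover have "int (y j) - int (y i) < int N" for i j
  proof -
    have "nat (d * int (q + j) mod int N) < N" using N by (simp add: nat_less_iff)
    then have "y j \<le> N" "1 \<le> y i" unfolding y_def by linarith+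
    then show ?thesis by linarith
  qed
  moreover have "int N dvd (int (y j) - int (y i)) - d * (int j - int i)" for i j
    using dvd_diff[OF lattice_value_dvd[OF N, of d q j] lattice_value_dvd[OF N, of d q i]]
    unfolding y_def by (simp add: algebra_simps)
  ultimately show thesis using that by blast
qed

text \<open>The divisibility hypothesis says that the form \<alpha> x + \<beta> y vanishes modulo N
  on the direction (1, d), which is what \<open>chain_length_le\<close> needs.\<close>

lemma lattice_list_increasing_sub:
  assumes "cyclic_sub \<tau> (Cyc (lattice_list N d))" "cyc_increasing \<tau>" "0 < N"
    and "0 < \<alpha> + \<beta>" and dvd: "int N dvd int \<alpha> + int \<beta> * d"
  shows "cyc_length \<tau> \<le> \<alpha> + \<beta>"
proof -
  obtain zs where zs: "\<tau> = Cyc zs" "sorted_wrt (<) zs" using assms(2) by (auto simp: cyc_increasing_def)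
  obtain q where "subseq zs (rotate q (lattice_list N d))"
    using cyclic_sub_subseq_rotate assms(1) zs(1) by blast
  then obtain ps y where ps: "sorted_wrt (<) ps" "set ps \<subseteq> {0..<N}" "zs = map y ps"
    and y: "\<And>i j. int (y j) - int (y i) < int N"
      "\<And>i j. int N dvd (int (y j) - int (y i)) - d * (int j - int i)"
    using subseq_rotate_lattice_listE assms(3) by blast
  have "length ps \<le> \<alpha> + \<beta>"
  proof (rule chain_length_le[OF ps(1,2), where y = "\<lambda>i. int (y i)"])
    show "sorted_wrt (\<lambda>i j. int (y i) < int (y j)) ps" using zs ps by (simp add: sorted_wrt_map)
    show "int N dvd int \<alpha> * (int j - int i) + int \<beta> * (int (y j) - int (y i))" for i j
      using dvd_add[OF dvd_mult2[OF dvd, of "int j - int i"] dvd_mult[OF y(2)[of j i], of "int \<beta>"]]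
      by (simp add: algebra_simps)
  qed (use y assms in auto)
  then show ?thesis using zs ps by (simp add: cyc_length.abs_eq)
qed

text \<open>The increasing argument applied to the negated values, which replaces d by -d.\<close>

lemma lattice_list_decreasing_sub:
  assumes "cyclic_sub \<tau> (Cyc (lattice_list N d))" "cyc_decreasing \<tau>" "0 < N"
    and "0 < \<alpha> + \<beta>" and dvd: "int N dvd int \<alpha> - int \<beta> * d"
  shows "cyc_length \<tau> \<le> \<alpha> + \<beta>"
proof -
  obtain zs where zs: "\<tau> = Cyc zs" "sorted_wrt (>) zs" using assms(2) by (auto simp: cyc_decreasing_def)
  obtain q where "subseq zs (rotate q (lattice_list N d))"
    using cyclic_sub_subseq_rotate assms(1) zs(1) by blast
  then obtain ps y where ps: "sorted_wrt (<) ps" "set ps \<subseteq> {0..<N}" "zs = map y ps"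
    and y: "\<And>i j. int (y j) - int (y i) < int N"
      "\<And>i j. int N dvd (int (y j) - int (y i)) - d * (int j - int i)"
    using subseq_rotate_lattice_listE assms(3) by blast
  have "length ps \<le> \<alpha> + \<beta>"
  proof (rule chain_length_le[OF ps(1,2), where y = "\<lambda>i. - int (y i)"])
    show "sorted_wrt (\<lambda>i j. - int (y i) < - int (y j)) ps" using zs ps by (simp add: sorted_wrt_map)
    show "- int (y j) - - int (y i) < int N" for i j using y(1)[of i j] by simp
    show "int N dvd int \<alpha> * (int j - int i) + int \<beta> * (- int (y j) - - int (y i))" for i j
      using dvd_diff[OF dvd_mult2[OF dvd, of "int j - int i"] dvd_mult[OF y(2)[of j i], of "int \<beta>"]]
      by (simp add: algebra_simps)
  qed (use assms in auto)
  then show ?thesis using zs ps by (simp add: cyc_length.abs_eq)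
qed

text \<open>The hypothesis makes d a unit modulo N with inverse -e. It is phrased this way because n
  m + 1 = N serves both d = n and d = -m.\<close>

lemma lattice_list_perm:
  assumes N: "0 < N" and unit: "int N dvd d * e + 1"
  shows "distinct (lattice_list N d)" "set (lattice_list N d) = {1..N}"
proof -
  have neq: "lattice_list N d ! p \<noteq> lattice_list N d ! q" if pq: "p < q" "q < N" for p q
  proof
    assume "lattice_list N d ! p = lattice_list N d ! q"
    then have "nat (d * int q mod int N) = nat (d * int p mod int N)" using pq by (simp add: lattice_list_nth)
    then have "d * int q mod int N = d * int p mod int N" using N by (simp add: nat_eq_iff)
    then have "int N dvd d * int q - d * int p" by (simp add: mod_eq_dvd_iff)
    from dvd_diff[OF dvd_mult2[OF unit, of "int q - int p"] dvd_mult[OF this, of e]]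
    have "int N dvd int q - int p" by (simp add: algebra_simps)
    then show False using zdvd_imp_le[of "int N" "int q - int p"] pq by auto
  qed
  show dist: "distinct (lattice_list N d)"
    unfolding distinct_conv_nth using neq by (metis length_lattice_list linorder_neqE_nat)
  show "set (lattice_list N d) = {1..N}"
  proof (rule card_subset_eq)
    have "nat (x mod int N) < N" for x using N by (simp add: nat_less_iff)
    then show "set (lattice_list N d) \<subseteq> {1..N}" by (auto simp: lattice_list_def Suc_le_eq)
    show "card (set (lattice_list N d)) = card {1..N}" using distinct_card[OF dist] by simp
  qed simp
qed

lemma Cyc_in_cyclic_perms: "Cyc xs \<in> cyclic_perms A \<longleftrightarrow> distinct xs \<and> set xs = A"
  by (simp add: cyclic_perms_def cyc_distinct.abs_eq cyc_set.abs_eq)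

lemma lattice_list_in_CC:
  fixes m n N :: nat
  assumes N: "N = m * n + 1" and d: "d = int n \<or> d = - int m"
  shows "Cyc (lattice_list N d) \<in> CC (m + 1) (n + 1)"
proof -
  have pos: "0 < N" and N': "int N = 1 + int m * int n" using N by simp_all
  obtain e where "int N dvd d * e + 1"
  proof (cases "d = int n")
    case True
    then show thesis using that[of "int m"] N' by (simp add: algebra_simps)
  next
    case False
    then show thesis using that[of "- int n"] N' d by (simp add: algebra_simps)
  qed
  note perm = lattice_list_perm[OF pos this]
  \<comment> \<open>The coefficients (\<alpha>, \<beta>) are (1, m) for d = n and (m, 1) for d = -m,
    with sum k. In the decreasing case they are (n, 1) and (1, n), with sum l.\<close>
  have inc: "cyc_length \<tau> \<le> m + 1" if "cyclic_sub \<tau> (Cyc (lattice_list N d))" "cyc_increasing \<tau>" for \<tau>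
    using d
  proof
    assume "d = int n"
    then show ?thesis using lattice_list_increasing_sub[OF that pos, of 1 m] N' by simp
  next
    assume "d = - int m"
    then show ?thesis using lattice_list_increasing_sub[OF that pos, of m 1] by simp
  qed
  have dec: "cyc_length \<tau> \<le> n + 1" if "cyclic_sub \<tau> (Cyc (lattice_list N d))" "cyc_decreasing \<tau>" for \<tau>
    using d
  proof
    assume "d = int n"
    then show ?thesis using lattice_list_decreasing_sub[OF that pos, of n 1] by simp
  next
    assume "d = - int m"
    then show ?thesis using lattice_list_decreasing_sub[OF that pos, of 1 n] N' by (simp add: mult.commute)
  qed
  show ?thesis
    unfolding CC_def using perm N inc dec by (fastforce simp: Cyc_in_cyclic_perms)
qed

lemma cyclic_perms_starting_at:
  assumes "\<sigma> \<in> cyclic_perms A" "a \<in> A"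
  obtains xs where "\<sigma> = Cyc (a # xs)" "distinct (a # xs)" "set (a # xs) = A"
proof -
  obtain ys where ys: "\<sigma> = Cyc ys" by (induction \<sigma> rule: cyc.abs_induct) blast
  then have "a \<in> set ys" using assms by (simp add: Cyc_in_cyclic_perms)
  then obtain us vs where "ys = us @ a # vs" by (meson split_list)
  then have eq: "\<sigma> = Cyc (a # (vs @ us))" using ys Cyc_append_commute[of us "a # vs"] by simp
  then show thesis using that[OF eq] assms(1) Cyc_in_cyclic_perms by metis
qed

text \<open>The two listed arrangements may coincide; the case distinction of the theorem is
  precisely whether they do.\<close>

lemma CC_eq:
  fixes m n N :: nat
  assumes N: "N = m * n + 1"
  shows "CC (m + 1) (n + 1) = {Cyc (lattice_list N (int n)), Cyc (lattice_list N (- int m))}"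
proof (rule antisym)
  show "{Cyc (lattice_list N (int n)), Cyc (lattice_list N (- int m))} \<subseteq> CC (m + 1) (n + 1)"
    using lattice_list_in_CC[OF N] by auto
  show "CC (m + 1) (n + 1) \<subseteq> {Cyc (lattice_list N (int n)), Cyc (lattice_list N (- int m))}"
  proof
    fix \<sigma> assume \<sigma>: "\<sigma> \<in> CC (m + 1) (n + 1)"
    then have "\<sigma> \<in> cyclic_perms {1..N}" by (simp add: CC_def N)
    moreover have "1 \<in> {1..N}" using N by simp
    ultimately obtain zs where zs: "\<sigma> = Cyc (1 # zs)" "distinct (1 # zs)" "set (1 # zs) = {1..N}"
      by (rule cyclic_perms_starting_at)
    let ?xs = "1 # zs"
    have len: "length ?xs = N" using distinct_card[OF zs(2)] unfolding zs(3) by simp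
    interpret extremal_arrangement m n N "heights ?xs"
      using CC_extremal_arrangement[OF N zs(2,3)] \<sigma> zs(1) by simp
    \<comment> \<open>Since the list starts with 1 and its values lie in 1..N, the congruence for
      the heights determines every entry.\<close>
    have lattice: "?xs = lattice_list N d" if d: "\<And>p. int N dvd heights ?xs p - heights ?xs 0 - d * int p" for d
    proof (rule nth_equalityI)
      fix p assume "p < length ?xs"
      then have p: "p < N" using len by simp
      then have mem: "?xs ! p \<in> {1..N}" using zs(3) len nth_mem by metis
      have "int N dvd (int (?xs ! p) - 1) - d * int p"
        using d[of p] p len by (simp add: heights_def)
      then have "(int (?xs ! p) - 1) mod int N = d * int p mod int N" by (simp only: mod_eq_dvd_iff)
      moreover have "(int (?xs ! p) - 1) mod int N = int (?xs ! p) - 1"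
        using mem by (intro mod_pos_pos_trivial) auto
      ultimately have "int (?xs ! p) = d * int p mod int N + 1" by simp
      then have "int (?xs ! p) = int (nat (d * int p mod int N) + 1)"
        using pos_mod_sign[OF N_pos, of "d * int p"] by simp
      then have "?xs ! p = nat (d * int p mod int N) + 1" by (simp only: of_nat_eq_iff)
      then show "?xs ! p = lattice_list N d ! p" using p by (simp only: lattice_list_nth)
    qed (use len in simp)
    from affine show "\<sigma> \<in> {Cyc (lattice_list N (int n)), Cyc (lattice_list N (- int m))}"
      using lattice[of "int n"] lattice[of "- int m"] zs(1) by auto
  qed
qed

section \<open>Normal forms starting with 1 and explicit lattice values\<close>

lemma Cyc_eq_same_start:
  assumes "Cyc xs = Cyc ys" "distinct xs" "xs \<noteq> []" "xs ! 0 = ys ! 0"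
  shows "xs = ys"
proof -
  obtain q where q: "ys = rotate q xs" using assms(1) Cyc_eq_iff by blast
  have "xs ! (q mod length xs) = xs ! 0" using assms(3,4) q by (simp add: nth_rotate)
  then have "q mod length xs = 0" using assms(2,3) by (simp add: nth_eq_iff_index_eq)
  then show ?thesis using q rotate_conv_mod[of q xs] by simp
qed

lemma Cyc_eq_lattice_list_iff:
  assumes "distinct (1 # map a [1..<N])" "0 < N"
  shows "Cyc (1 # map a [1..<N]) = Cyc (lattice_list N d) \<longleftrightarrow>
    (\<forall>p\<in>{1..<N}. a p = nat (d * int p mod int N) + 1)"
proof -
  let ?xs = "1 # map a [1..<N]"
  have "lattice_list N d = 1 # map (\<lambda>p. nat (d * int p mod int N) + 1) [1..<N]"
    using assms(2) by (simp add: lattice_list_def upt_conv_Cons)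
  then have "?xs = lattice_list N d \<longleftrightarrow> (\<forall>p\<in>{1..<N}. a p = nat (d * int p mod int N) + 1)"
    by auto
  moreover have "Cyc ?xs = Cyc (lattice_list N d) \<longleftrightarrow> ?xs = lattice_list N d"
    using Cyc_eq_same_start[of ?xs "lattice_list N d"] assms by (auto simp: lattice_list_nth)
  ultimately show ?thesis by simp
qed

text \<open>Euclidean division of p - 1 by the block length \<open>w\<close>, with quotient j - 1
  and remainder i - 1.\<close>

lemma ball_block_index:
  fixes u w :: nat
  shows "(\<forall>p\<in>{1..<u * w + 1}. P p) \<longleftrightarrow> (\<forall>i\<in>{1..w}. \<forall>j\<in>{1..u}. P ((j - 1) * w + i))"
proof (intro iffI ballI)
  fix i j assume P: "\<forall>p\<in>{1..<u * w + 1}. P p" and ij: "i \<in> {1..w}" "j \<in> {1..u}"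
  have "(j - 1) * w + i \<le> (j - 1) * w + w" using ij by simp
  also have "\<dots> = j * w" using ij by (cases j) auto
  also have "\<dots> \<le> u * w" using ij by simp
  finally show "P ((j - 1) * w + i)" using P ij by auto
next
  fix p assume P: "\<forall>i\<in>{1..w}. \<forall>j\<in>{1..u}. P ((j - 1) * w + i)" and p: "p \<in> {1..<u * w + 1}"
  have w: "0 < w" using p by (cases w) auto
  have "(p - 1) div w < u" using p w by (simp add: div_less_iff_less_mult) linarith
  moreover have "(p - 1) mod w < w" using w by simp
  ultimately have "P (((p - 1) div w + 1 - 1) * w + ((p - 1) mod w + 1))"
    using P by (metis (no_types, lifting) atLeastAtMost_iff le_add2 Suc_eq_plus1 Suc_leI)
  moreover have "((p - 1) div w + 1 - 1) * w + ((p - 1) mod w + 1) = p" using p by simp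
  ultimately show "P p" by simp
qed

lemma lattice_value_neg:
  fixes m n i j :: nat
  assumes "i \<in> {1..n}" "j \<in> {1..m}"
  shows "nat (- int m * int ((j - 1) * n + i) mod int (m * n + 1)) + 1 = (n - i) * m + j + 1"
proof -
  \<comment> \<open>Writing n and j additively removes the truncated subtractions, so that the
    integer identity, with quotient -j modulo m n + 1, becomes plain algebra.\<close>
  obtain x y where "n = i + x" "j = Suc y"
    using assms by (metis atLeastAtMost_iff le_Suc_ex One_nat_def Suc_le_D)
  then have "- int m * int ((j - 1) * n + i) = int ((n - i) * m + j) - int j * int (m * n + 1)"
    by (simp add: algebra_simps)
  then have "- int m * int ((j - 1) * n + i) mod int (m * n + 1) = int ((n - i) * m + j) mod int (m * n + 1)"
    by (metis mod_diff_eq mod_mult_self2_is_0 diff_zero mod_mod_trivial)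
  also have "\<dots> = int ((n - i) * m + j)"
  proof (rule mod_pos_pos_trivial)
    have "(n - i) * m \<le> (n - 1) * m" using assms by (intro mult_right_mono) auto
    moreover have "(n - 1) * m + m = m * n" using assms by (cases n) auto
    moreover have "j \<le> m" using assms by simp
    ultimately have "(n - i) * m + j \<le> m * n" by linarith
    then show "int ((n - i) * m + j) < int (m * n + 1)" by (simp only: of_nat_less_iff)
  qed simp
  finally show ?thesis by (simp only: nat_int)
qed

lemma lattice_value_pos:
  fixes m n i j :: nat
  assumes "i \<in> {1..n}" "j \<in> {1..m}"
  shows "nat (int n * int ((i - 1) * m + j) mod int (m * n + 1)) + 1 = (j - 1) * n + (n + 1 - i) + 1"
proof -
  \<comment> \<open>The same device; here the quotient modulo m n + 1 is i - 1.\<close>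
  obtain x y z where "n = i + x" "j = Suc y" "i = Suc z"
    using assms by (metis atLeastAtMost_iff le_Suc_ex One_nat_def Suc_le_D)
  then have "int n * int ((i - 1) * m + j) = int ((j - 1) * n + (n + 1 - i)) + int (i - 1) * int (m * n + 1)"
    by (simp add: algebra_simps)
  then have "int n * int ((i - 1) * m + j) mod int (m * n + 1) = int ((j - 1) * n + (n + 1 - i)) mod int (m * n + 1)"
    by (simp only: mod_mult_self1)
  also have "\<dots> = int ((j - 1) * n + (n + 1 - i))"
  proof (rule mod_pos_pos_trivial)
    have "(j - 1) * n \<le> (m - 1) * n" using assms by (intro mult_right_mono) auto
    moreover have "(m - 1) * n + n = m * n" using assms by (cases m) auto
    moreover have "n + 1 - i \<le> n" using assms by auto
    ultimately have "(j - 1) * n + (n + 1 - i) \<le> m * n" by linarith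
    then show "int ((j - 1) * n + (n + 1 - i)) < int (m * n + 1)" by (simp only: of_nat_less_iff)
  qed simp
  finally show ?thesis by (simp only: nat_int)
qed

section \<open>Monotone arrangements as the lattices of step 1 and -1\<close>

lemma increasing_perm_unique:
  assumes "\<sigma> \<in> cyclic_perms A" "\<tau> \<in> cyclic_perms A" "cyc_increasing \<sigma>" "cyc_increasing \<tau>"
  shows "\<sigma> = \<tau>"
  using assms by (auto simp: cyc_increasing_def Cyc_in_cyclic_perms dest: strict_sorted_equal)

lemma decreasing_perm_unique:
  fixes A :: "'a::linorder set"
  assumes "\<sigma> \<in> cyclic_perms A" "\<tau> \<in> cyclic_perms A" "cyc_decreasing \<sigma>" "cyc_decreasing \<tau>"
  shows "\<sigma> = \<tau>"
proof -
  obtain xs ys where "\<sigma> = Cyc xs" "\<tau> = Cyc ys" "sorted_wrt (>) xs" "sorted_wrt (>) ys"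
    using assms(3,4) by (auto simp: cyc_decreasing_def)
  moreover from this have "sorted_wrt (<) (rev xs)" "sorted_wrt (<) (rev ys)" "set (rev xs) = set (rev ys)"
    using assms(1,2) by (simp_all add: sorted_wrt_rev Cyc_in_cyclic_perms)
  then have "rev xs = rev ys" by (metis strict_sorted_equal)
  ultimately show ?thesis by simp
qed

lemma cyc_increasing_lattice_list:
  assumes "0 < N" "int N dvd d - 1"
  shows "cyc_increasing (Cyc (lattice_list N d))"
proof -
  have "d * int p mod int N = int p" if "p < N" for p
  proof -
    have "int N dvd d * int p - int p" using dvd_mult2[OF assms(2), of "int p"] by (simp add: algebra_simps)
    then have "d * int p mod int N = int p mod int N" by (simp add: mod_eq_dvd_iff)
    then show ?thesis using that by simp
  qed
  then have "lattice_list N d = map Suc [0..<N]" by (simp add: lattice_list_def)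
  then have "sorted_wrt (<) (lattice_list N d)" by (simp add: sorted_wrt_map)
  then show ?thesis by (auto simp: cyc_increasing_def)
qed

lemma cyc_decreasing_lattice_list:
  assumes "0 < N" "int N dvd d + 1"
  shows "cyc_decreasing (Cyc (lattice_list N d))"
proof -
  have val: "nat (d * int p mod int N) + 1 = N + 1 - p" if "p \<in> {1..<N}" for p
  proof -
    have "int N dvd (d + 1) * int p - int N" using dvd_mult2[OF assms(2), of "int p"] by (intro dvd_diff) auto
    then have "int N dvd d * int p - int (N - p)" using that by (simp add: algebra_simps of_nat_diff)
    then have "d * int p mod int N = int (N - p) mod int N" by (simp only: mod_eq_dvd_iff)
    also have "\<dots> = int (N - p)" using that by (intro mod_pos_pos_trivial) auto
    finally have "nat (d * int p mod int N) = N - p" by (simp only: nat_int)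
    then show ?thesis using that by auto
  qed
  have "lattice_list N d = [1] @ map (\<lambda>p. nat (d * int p mod int N) + 1) [1..<N]"
    using assms(1) by (simp add: lattice_list_def upt_conv_Cons)
  also have "map (\<lambda>p. nat (d * int p mod int N) + 1) [1..<N] = map (\<lambda>p. N + 1 - p) [1..<N]"
    by (rule map_cong) (use val in auto)
  \<comment> \<open>The list reads 1, N, N - 1, ..., 2; rotating the leading 1 to the end makes it
    decreasing.\<close>
  finally have "Cyc (lattice_list N d) = Cyc (map (\<lambda>p. N + 1 - p) [1..<N] @ [1])"
    using Cyc_append_commute by metis
  moreover have "sorted_wrt (>) (map (\<lambda>p. N + 1 - p) [1..<N] @ [1])"
    by (auto simp: sorted_wrt_append sorted_wrt_map intro!: sorted_wrt_mono_rel[OF _ sorted_wrt_upt])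
  ultimately show ?thesis by (auto simp: cyc_decreasing_def)
qed

theorem theorem3:
  fixes k l :: nat
  assumes "k \<ge> 1" and "l \<ge> 1"
  shows
    "(min k l \<le> 2 \<longrightarrow>
        card (CC k l) = 1 \<and>
        (k \<le> 2 \<longrightarrow> CC k l = {\<sigma> \<in> cyclic_perms {1..(k - 1) * (l - 1) + 1}. cyc_decreasing \<sigma>}) \<and>
        (k \<ge> 3 \<longrightarrow> CC k l = {\<sigma> \<in> cyclic_perms {1..(k - 1) * (l - 1) + 1}. cyc_increasing \<sigma>})) \<and>
     (min k l \<ge> 3 \<longrightarrow>
        card (CC k l) = 2 \<and>
        (\<forall>a :: nat \<Rightarrow> nat.
          Cyc (1 # map a [1..<(k - 1) * (l - 1) + 1]) \<in> cyclic_perms {1..(k - 1) * (l - 1) + 1} \<longrightarrow>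
          (Cyc (1 # map a [1..<(k - 1) * (l - 1) + 1]) \<in> CC k l \<longleftrightarrow>
            (\<forall>i\<in>{1..l - 1}. \<forall>j\<in>{1..k - 1}.
               a ((j - 1) * (l - 1) + i) = (l - 1 - i) * (k - 1) + j + 1) \<or>
            (\<forall>i\<in>{1..l - 1}. \<forall>j\<in>{1..k - 1}.
               a ((i - 1) * (k - 1) + j) = (j - 1) * (l - 1) + (l - i) + 1))))"
proof -
  define m n N where "m = k - 1" and "n = l - 1" and "N = m * n + 1"
  have kl: "k = m + 1" "l = n + 1" using assms by (simp_all add: m_def n_def)
  have pos: "0 < N" and N': "int N = 1 + int m * int n" by (simp_all add: N_def)
  let ?L = "\<lambda>d. Cyc (lattice_list N d)"
  have CC: "CC k l = {?L (int n), ?L (- int m)}" using CC_eq[OF N_def] kl by simp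
  have sub: "CC k l \<subseteq> cyclic_perms {1..N}" by (auto simp: CC_def kl N_def)
  have dec: "CC k l = {\<sigma> \<in> cyclic_perms {1..N}. cyc_decreasing \<sigma>} \<and> card (CC k l) = 1" if "k \<le> 2"
  proof -
    \<comment> \<open>For m = 0 the modulus is 1; for m = 1 it is n + 1. Either way both steps n and
      -m are congruent to -1.\<close>
    consider "m = 0" | "m = 1" using \<open>k \<le> 2\<close> kl by linarith
    then have "int N dvd int n + 1 \<and> int N dvd - int m + 1" by cases (simp_all add: N' add.commute)
    then have "cyc_decreasing \<sigma>" if "\<sigma> \<in> CC k l" for \<sigma>
      using that cyc_decreasing_lattice_list[OF pos] CC by auto
    then have le: "CC k l \<subseteq> {\<sigma> \<in> cyclic_perms {1..N}. cyc_decreasing \<sigma>}" using sub by blast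
    have mem: "?L (int n) \<in> CC k l" using CC by simp
    have "{\<sigma> \<in> cyclic_perms {1..N}. cyc_decreasing \<sigma>} \<subseteq> {?L (int n)}"
    proof
      fix \<sigma> assume "\<sigma> \<in> {\<sigma> \<in> cyclic_perms {1..N}. cyc_decreasing \<sigma>}"
      then show "\<sigma> \<in> {?L (int n)}" using le mem decreasing_perm_unique[of \<sigma> "{1..N}" "?L (int n)"] by blast
    qed
    then have "CC k l = {?L (int n)}" "{\<sigma> \<in> cyclic_perms {1..N}. cyc_decreasing \<sigma>} = {?L (int n)}"
      using le mem by blast+
    then show ?thesis by simp
  qed
  have inc: "CC k l = {\<sigma> \<in> cyclic_perms {1..N}. cyc_increasing \<sigma>} \<and> card (CC k l) = 1" if "l \<le> 2"
  proof -
    \<comment> \<open>Dually, the modulus is 1 or m + 1, and both steps are congruent to 1.\<close>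
    consider "n = 0" | "n = 1" using \<open>l \<le> 2\<close> kl by linarith
    then have "int N dvd int n - 1 \<and> int N dvd - int m - 1"
    proof cases
      case 2
      have "- int m - 1 = int N * (- 1)" using 2 N' by simp
      then show ?thesis using 2 by (metis dvd_triv_left dvd_0_right of_nat_1 diff_self)
    qed (simp_all add: N')
    then have "cyc_increasing \<sigma>" if "\<sigma> \<in> CC k l" for \<sigma>
      using that cyc_increasing_lattice_list[OF pos] CC by auto
    then have le: "CC k l \<subseteq> {\<sigma> \<in> cyclic_perms {1..N}. cyc_increasing \<sigma>}" using sub by blast
    have mem: "?L (int n) \<in> CC k l" using CC by simp
    have "{\<sigma> \<in> cyclic_perms {1..N}. cyc_increasing \<sigma>} \<subseteq> {?L (int n)}"
    proof
      fix \<sigma> assume "\<sigma> \<in> {\<sigma> \<in> cyclic_perms {1..N}. cyc_increasing \<sigma>}"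
      then show "\<sigma> \<in> {?L (int n)}" using le mem increasing_perm_unique[of \<sigma> "{1..N}" "?L (int n)"] by blast
    qed
    then have "CC k l = {?L (int n)}" "{\<sigma> \<in> cyclic_perms {1..N}. cyc_increasing \<sigma>} = {?L (int n)}"
      using le mem by blast+
    then show ?thesis by simp
  qed
  have two: "card (CC k l) = 2" if "min k l \<ge> 3"
  proof -
    have mn: "2 \<le> m" "2 \<le> n" using that kl by auto
    have "lattice_list N (int n) \<noteq> lattice_list N (- int m)"
    proof
      assume "lattice_list N (int n) = lattice_list N (- int m)"
      then have "lattice_list N (int n) ! 1 = lattice_list N (- int m) ! 1" by simp
      moreover have "1 < N" using mn by (simp add: N_def)
      ultimately have "int n mod int N = - int m mod int N"
        by (simp add: lattice_list_nth nat_eq_iff)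
      then have "int N dvd int n + int m" by (simp add: mod_eq_dvd_iff)
      then have "N dvd n + m" by (simp only: of_nat_add[symmetric] int_dvd_int_iff)
      then have "N \<le> n + m" using mn by (intro dvd_imp_le) auto
      \<comment> \<open>This is (m - 2)(n - 2) >= 0. Combined with m n + 1 <= m + n it would give m
        + n <= 3, against m, n >= 2.\<close>
      moreover have "2 * m + 2 * n \<le> m * n + 4"
      proof -
        obtain x y where "m = x + 2" "n = y + 2" using mn by (metis le_add_diff_inverse2)
        then show ?thesis by (simp add: algebra_simps)
      qed
      ultimately show False using mn by (simp add: N_def)
    qed
    moreover have "distinct (lattice_list N (int n))"
      by (rule lattice_list_perm[OF pos, of _ "int m"]) (simp add: N' algebra_simps)
    ultimately have "?L (int n) \<noteq> ?L (- int m)"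
      using Cyc_eq_same_start[of "lattice_list N (int n)" "lattice_list N (- int m)"] pos
      by (auto simp: lattice_list_nth simp flip: length_0_conv)
    then show ?thesis using CC by simp
  qed
  have char: "Cyc (1 # map a [1..<N]) \<in> CC k l \<longleftrightarrow>
      (\<forall>i\<in>{1..n}. \<forall>j\<in>{1..m}. a ((j - 1) * n + i) = (n - i) * m + j + 1) \<or>
      (\<forall>i\<in>{1..n}. \<forall>j\<in>{1..m}. a ((i - 1) * m + j) = (j - 1) * n + (l - i) + 1)"
    if perm: "Cyc (1 # map a [1..<N]) \<in> cyclic_perms {1..N}" for a
  proof -
    have dist: "distinct (1 # map a [1..<N])" using perm by (simp only: Cyc_in_cyclic_perms)
    have "Cyc (1 # map a [1..<N]) = ?L (- int m) \<longleftrightarrow>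
        (\<forall>i\<in>{1..n}. \<forall>j\<in>{1..m}. a ((j - 1) * n + i) = (n - i) * m + j + 1)"
      unfolding Cyc_eq_lattice_list_iff[OF dist pos] unfolding N_def ball_block_index
      by (intro ball_cong refl) (simp only: lattice_value_neg)
    moreover have "Cyc (1 # map a [1..<N]) = ?L (int n) \<longleftrightarrow>
        (\<forall>i\<in>{1..n}. \<forall>j\<in>{1..m}. a ((i - 1) * m + j) = (j - 1) * n + (l - i) + 1)"
    proof -
      have "Cyc (1 # map a [1..<N]) = ?L (int n) \<longleftrightarrow>
          (\<forall>j\<in>{1..m}. \<forall>i\<in>{1..n}. a ((i - 1) * m + j) =
            nat (int n * int ((i - 1) * m + j) mod int (n * m + 1)) + 1)"
        \<comment> \<open>Formula (ii) uses blocks of length m rather than n, so the block lemma is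
          applied with the factors exchanged.\<close>
        unfolding Cyc_eq_lattice_list_iff[OF dist pos] unfolding N_def mult.commute[of m n] ball_block_index ..
      also have "\<dots> \<longleftrightarrow> (\<forall>j\<in>{1..m}. \<forall>i\<in>{1..n}. a ((i - 1) * m + j) = (j - 1) * n + (l - i) + 1)"
        unfolding kl mult.commute[of n m] by (intro ball_cong refl) (simp only: lattice_value_pos)
      finally show ?thesis by blast
    qed
    ultimately show ?thesis using CC by auto
  qed
  show ?thesis
    unfolding m_def[symmetric] n_def[symmetric] N_def[symmetric]
    using dec inc two char by (auto simp: min_def split: if_splits)
qed

end
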